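(* Let $\Phi=(G,\varphi)$ be a complex unit gain graph of order $n$ with $r(\Phi)=r(G)+2\theta(G)$. Then (i) the cycles (if any) of $G$ are pairwise vertex-disjoint; (ii) each cycle $C_p^{\varphi}$ of $\Phi$ is of Type B with order $p\equiv 0\pmod 4$; (iii) $r(G)=r(T_G)+\sum_{O\in\mathcal{C}(G)}(|V(O)|-2)$ and $r(T_G)=r(\Gamma_G)$.
   Context: A complex unit gain graph $\Phi=(G,\varphi)$ consists of a finite simple graph $G$ with vertex set $\{v_1,\dots,v_n\}$ and a gain function $\varphi$ assigning to each oriented edge $e_{ij}$ ($v_iv_j\in E(G)$) a complex number of modulus $1$ with $\varphi(e_{ji})=\overline{\varphi(e_{ij})}$. $A(\Phi)$ is the Hermitian matrix with $(i,j)$ entry $\varphi(e_{ij})$ if $v_iv_j\in E(G)$ and $0$ otherwise; $r(\Phi)$ is its rank; $r(\cdot)$ of a simple graph is the rank of its $0$-$1$ adjacency matrix. $\theta(G)=|E(G)|-|V(G)|+\omega(G)$, $\omega(G)$ the number of components. For a gain cycle with vertices $v_1,\dots,v_p$ in cyclic order, $\varphi(C_p)=\varphi(e_{12})\cdots\varphi(e_{p1})$; for $p$ even it is of Type B if $\varphi(C_p)\neq(-1)^{p/2}$. For a graph $G$ whose cycles are pairwise vertex-disjoint, $\mathcal{C}(G)$ is its set of cycles, and $T_G$ is the acyclic graph obtained by contracting each cycle $O$ to a vertex $t_O$: its vertex set is $U\cup C_G$, where $U$ is the set of vertices of $G$ on no cycle and $C_G=\{t_O:O\in\mathcal{C}(G)\}$;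 $u_1,u_2\in U$ are adjacent iff $u_1u_2\in E(G)$; $u\in U$ is adjacent to $t_O$ iff $u$ is adjacent in $G$ to some vertex of $O$; $t_{O_1},t_{O_2}$ are adjacent iff some edge of $G$ joins a vertex of $O_1$ to a vertex of $O_2$. $\Gamma_G$ is obtained from $T_G$ by deleting the vertices of $C_G$ and their incident edges. *)

theory Defs
  imports "Jordan_Normal_Form.DL_Rank"
begin

text \<open>Rank of a square matrix indexed by a finite set S, with entries M i j.
  The matrix is transported to a JNF matrix via an (arbitrary) enumeration of S;
  the rank does not depend on the chosen enumeration.\<close>
definition enum_of :: "'a set \<Rightarrow> nat \<Rightarrow> 'a" where
  "enum_of S = (SOME f. bij_betw f {..<card S} S)"

definition rank_on :: "'a set \<Rightarrow> ('a \<Rightarrow> 'a \<Rightarrow> 'b::field) \<Rightarrow> nat" where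
  "rank_on S M = vec_space.rank (card S)
     (mat (card S) (card S) (\<lambda>(i, j). M (enum_of S i) (enum_of S j)))"

definition simple_graph :: "'a set \<Rightarrow> ('a \<Rightarrow> 'a \<Rightarrow> bool) \<Rightarrow> bool" where
  "simple_graph V E \<longleftrightarrow> finite V \<and> (\<forall>u v. E u v \<longrightarrow> u \<in> V \<and> v \<in> V)
     \<and> (\<forall>u v. E u v \<longrightarrow> E v u) \<and> (\<forall>v. \<not> E v v)"

definition gain_graph :: "'a set \<Rightarrow> ('a \<Rightarrow> 'a \<Rightarrow> bool) \<Rightarrow> ('a \<Rightarrow> 'a \<Rightarrow> complex) \<Rightarrow> bool" where
  "gain_graph V E \<phi> \<longleftrightarrow> simple_graph V E
     \<and> (\<forall>u v. E u v \<longrightarrow> cmod (\<phi> u v) = 1 \<and> \<phi> v u = cnj (\<phi> u v))"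

definition adj :: "('a \<Rightarrow> 'a \<Rightarrow> bool) \<Rightarrow> 'a \<Rightarrow> 'a \<Rightarrow> real" where
  "adj E u v = (if E u v then 1 else 0)"

definition gain_adj :: "('a \<Rightarrow> 'a \<Rightarrow> bool) \<Rightarrow> ('a \<Rightarrow> 'a \<Rightarrow> complex) \<Rightarrow> 'a \<Rightarrow> 'a \<Rightarrow> complex" where
  "gain_adj E \<phi> u v = (if E u v then \<phi> u v else 0)"

definition graph_rank :: "'a set \<Rightarrow> ('a \<Rightarrow> 'a \<Rightarrow> bool) \<Rightarrow> nat" where
  "graph_rank V E = rank_on V (adj E)"

definition gain_rank :: "'a set \<Rightarrow> ('a \<Rightarrow> 'a \<Rightarrow> bool) \<Rightarrow> ('a \<Rightarrow> 'a \<Rightarrow> complex) \<Rightarrow> nat" where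
  "gain_rank V E \<phi> = rank_on V (gain_adj E \<phi>)"

definition edges :: "'a set \<Rightarrow> ('a \<Rightarrow> 'a \<Rightarrow> bool) \<Rightarrow> 'a set set" where
  "edges V E = {{u, v} | u v. u \<in> V \<and> v \<in> V \<and> E u v}"

definition components :: "'a set \<Rightarrow> ('a \<Rightarrow> 'a \<Rightarrow> bool) \<Rightarrow> 'a set set" where
  "components V E = (\<lambda>v. {w. (\<lambda>x y. x \<in> V \<and> y \<in> V \<and> E x y)\<^sup>*\<^sup>* v w}) ` V"

definition theta :: "'a set \<Rightarrow> ('a \<Rightarrow> 'a \<Rightarrow> bool) \<Rightarrow> int" where
  "theta V E = int (card (edges V E)) - int (card V) + int (card (components V E))"

definition is_cycle_list :: "'a set \<Rightarrow> ('a \<Rightarrow> 'a \<Rightarrow> bool) \<Rightarrow> 'a list \<Rightarrow> bool" where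
  "is_cycle_list V E xs \<longleftrightarrow> length xs \<ge> 3 \<and> distinct xs \<and> set xs \<subseteq> V
     \<and> (\<forall>i < length xs. E (xs ! i) (xs ! ((i + 1) mod length xs)))"

definition cycle_edges :: "'a list \<Rightarrow> 'a set set" where
  "cycle_edges xs = {{xs ! i, xs ! ((i + 1) mod length xs)} | i. i < length xs}"

definition cycle_of :: "'a list \<Rightarrow> 'a set \<times> 'a set set" where
  "cycle_of xs = (set xs, cycle_edges xs)"

definition cycles :: "'a set \<Rightarrow> ('a \<Rightarrow> 'a \<Rightarrow> bool) \<Rightarrow> ('a set \<times> 'a set set) set" where
  "cycles V E = cycle_of ` {xs. is_cycle_list V E xs}"

definition cycles_vertex_disjoint :: "'a set \<Rightarrow> ('a \<Rightarrow> 'a \<Rightarrow> bool) \<Rightarrow> bool" where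
  "cycles_vertex_disjoint V E \<longleftrightarrow>
     (\<forall>C1 \<in> cycles V E. \<forall>C2 \<in> cycles V E. C1 \<noteq> C2 \<longrightarrow> fst C1 \<inter> fst C2 = {})"

definition cycle_gain :: "('a \<Rightarrow> 'a \<Rightarrow> complex) \<Rightarrow> 'a list \<Rightarrow> complex" where
  "cycle_gain \<phi> xs = (\<Prod>i < length xs. \<phi> (xs ! i) (xs ! ((i + 1) mod length xs)))"

definition type_B :: "('a \<Rightarrow> 'a \<Rightarrow> complex) \<Rightarrow> 'a list \<Rightarrow> bool" where
  "type_B \<phi> xs \<longleftrightarrow> even (length xs) \<and> cycle_gain \<phi> xs \<noteq> (-1) ^ (length xs div 2)"

definition acyc_vertices :: "'a set \<Rightarrow> ('a \<Rightarrow> 'a \<Rightarrow> bool) \<Rightarrow> 'a set" where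
  "acyc_vertices V E = {v \<in> V. \<forall> Cy \<in> cycles V E. v \<notin> fst Cy}"

text \<open>T_G: vertices Inl u (u \<in> U) and Inr Cy (the contracted vertex t_O of cycle Cy).\<close>
definition TG_vertices :: "'a set \<Rightarrow> ('a \<Rightarrow> 'a \<Rightarrow> bool) \<Rightarrow> ('a + ('a set \<times> 'a set set)) set" where
  "TG_vertices V E = Inl ` acyc_vertices V E \<union> Inr ` cycles V E"

fun TG_adj_rel :: "'a set \<Rightarrow> ('a \<Rightarrow> 'a \<Rightarrow> bool) \<Rightarrow>
    ('a + ('a set \<times> 'a set set)) \<Rightarrow> ('a + ('a set \<times> 'a set set)) \<Rightarrow> bool" where
  "TG_adj_rel V E (Inl u1) (Inl u2) \<longleftrightarrow>
     u1 \<in> acyc_vertices V E \<and> u2 \<in> acyc_vertices V E \<and> E u1 u2"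
| "TG_adj_rel V E (Inl u) (Inr Cy) \<longleftrightarrow>
     u \<in> acyc_vertices V E \<and> Cy \<in> cycles V E \<and> (\<exists>w \<in> fst Cy. E u w)"
| "TG_adj_rel V E (Inr Cy) (Inl u) \<longleftrightarrow>
     u \<in> acyc_vertices V E \<and> Cy \<in> cycles V E \<and> (\<exists>w \<in> fst Cy. E u w)"
| "TG_adj_rel V E (Inr C1) (Inr C2) \<longleftrightarrow>
     C1 \<in> cycles V E \<and> C2 \<in> cycles V E \<and> C1 \<noteq> C2 \<and> (\<exists>a \<in> fst C1. \<exists>b \<in> fst C2. E a b)"

text \<open>Gamma_G: T_G minus the contracted vertices, i.e. the subgraph of G induced by U.\<close>
definition Gamma_adj_rel :: "'a set \<Rightarrow> ('a \<Rightarrow> 'a \<Rightarrow> bool) \<Rightarrow> 'a \<Rightarrow> 'a \<Rightarrow> bool" where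
  "Gamma_adj_rel V E u v \<longleftrightarrow> u \<in> acyc_vertices V E \<and> v \<in> acyc_vertices V E \<and> E u v"

end

theory Submission
  imports Defs "HOL-Library.Function_Algebras"
begin

text \<open>
  Deleting a vertex changes a rank by at most 2 and, if the vertex lies on a cycle, lowers
  \<open>\<theta>\<close>; induction gives \<open>r(\<Phi>) \<le> r(G) + 2\<theta>(G)\<close>, forests being switching equivalent to their
  underlying graphs. Call \<open>\<Phi>\<close> extremal if equality holds. Then for every \<open>v\<close> on a cycle,
  \<open>\<Phi> - v\<close> is extremal, \<open>r(G - v) = r(G)\<close>, \<open>r(\<Phi>) = r(\<Phi> - v) + 2\<close> and \<open>\<theta>\<close> drops by exactly 1,
  which forces the cycles to be disjoint.

  Let an edge \<open>p w\<close> leave a cycle at \<open>p\<close>; it is a bridge. Since \<open>r(G - p) = r(G)\<close>, there is a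
  kernel vector of \<open>A(G)\<close> with entry 1 at \<open>p\<close>. Cutting it off along the bridge and projecting it
  to one colour class of the (bipartite) side of \<open>w\<close> gives \<open>z\<close> with \<open>A(G) z = e\<^sub>w\<close> and \<open>z\<^sub>w = 0\<close>,
  so \<open>r(G) = r(G - w) + 2\<close>; hence \<open>w\<close> lies on no cycle, and both \<open>\<Phi> - w\<close> and \<open>\<Phi> - pw\<close> are
  extremal. Deletions of this kind reduce (ii) to an isolated cycle, where the kernel equations
  decide everything. Deleting all edges that leave cycles gives \<open>r(G) = r(\<Gamma>\<^sub>G) + \<Sum>(|V(O)| - 2)\<close>;
  comparing this formula for \<open>G\<close> and \<open>G - w\<close> gives \<open>r(\<Gamma>\<^sub>G) = r(\<Gamma>\<^sub>G - w) + 2\<close>, and induction on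
  \<open>T\<^sub>G - w\<close> squeezes \<open>r(T\<^sub>G)\<close> between \<open>r(\<Gamma>\<^sub>G)\<close> and \<open>r(\<Gamma>\<^sub>G - w) + 2\<close>.
\<close>

section \<open>Ranks of matrices indexed by sets\<close>

text \<open>With the pointwise addition of \<open>Function_Algebras\<close>, this scaling makes all
  functions into a vector space, so that \<open>span\<close> and \<open>dim\<close> are available
  without fixing a dimension or an enumeration of the indices.\<close>

definition fscale :: "'b::field \<Rightarrow> ('a \<Rightarrow> 'b) \<Rightarrow> 'a \<Rightarrow> 'b" where
  "fscale c f = (\<lambda>x. c * f x)"

interpretation fv: vector_space fscale
  by unfold_locales (simp_all add: fscale_def fun_eq_iff algebra_simps)

lemma sum_fun_at: "(\<Sum>a\<in>A. f a) x = (\<Sum>a\<in>A. f a x)"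
  for f :: "'c \<Rightarrow> 'a \<Rightarrow> 'b::comm_monoid_add"
  by (induction A rule: infinite_finite_induct) auto

text \<open>The column is extended by 0 outside \<open>R\<close>, so that equality of functions is
  equality on the rows in \<open>R\<close>.\<close>

definition colv :: "'r set \<Rightarrow> ('r \<Rightarrow> 'c \<Rightarrow> 'b::field) \<Rightarrow> 'c \<Rightarrow> 'r \<Rightarrow> 'b" where
  "colv R M j = (\<lambda>i. if i \<in> R then M i j else 0)"

text \<open>Column rank of a submatrix. Row and column sets are separate so that a vertex can be
  removed in two moves, first one line and then the other, each changing the rank by at most
  1.\<close>

definition rk :: "'r set \<Rightarrow> 'c set \<Rightarrow> ('r \<Rightarrow> 'c \<Rightarrow> 'b::field) \<Rightarrow> nat" where
  "rk R C M = fv.dim (colv R M ` C)"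

definition col_dep :: "'r set \<Rightarrow> 'c set \<Rightarrow> ('r \<Rightarrow> 'c \<Rightarrow> 'b::field) \<Rightarrow> 'c \<Rightarrow> bool" where
  "col_dep R C M j \<longleftrightarrow> (\<exists>x. \<forall>i\<in>R. M i j = (\<Sum>c\<in>C. M i c * x c))"

lemma col_depI:
  "(\<And>i. i \<in> R \<Longrightarrow> M i j = (\<Sum>c\<in>C. M i c * x c)) \<Longrightarrow> col_dep R C M j"
  unfolding col_dep_def by blast

text \<open>Coefficients are attached to indices rather than to vectors, because distinct indices
  may give the same column.\<close>

lemma span_image_explicit:
  assumes "finite C"
  shows "v \<in> fv.span (g ` C) \<longleftrightarrow> (\<exists>x. v = (\<Sum>c\<in>C. fscale (x c) (g c)))"
  using assms
proof (induction C arbitrary: v rule: finite_induct)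
  case (insert c C)
  show ?case
  proof
    assume "v \<in> fv.span (g ` insert c C)"
    then obtain k where "v - fscale k (g c) \<in> fv.span (g ` C)"
      by (auto simp: fv.span_insert)
    then obtain x where x: "v - fscale k (g c) = (\<Sum>c\<in>C. fscale (x c) (g c))"
      using insert.IH by blast
    have "(\<Sum>d\<in>C. fscale ((x(c := k)) d) (g d)) = (\<Sum>c\<in>C. fscale (x c) (g c))"
      by (rule sum.cong) (use insert.hyps in auto)
    then have "v = (\<Sum>d\<in>insert c C. fscale ((x(c := k)) d) (g d))"
      using insert.hyps x by (simp add: algebra_simps)
    then show "\<exists>x. v = (\<Sum>c\<in>insert c C. fscale (x c) (g c))" by blast
  next
    assume "\<exists>x. v = (\<Sum>c\<in>insert c C. fscale (x c) (g c))"
    then show "v \<in> fv.span (g ` insert c C)"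
      by (auto intro!: fv.span_sum fv.span_scale intro: fv.span_base)
  qed
qed auto

lemma colv_in_span_iff:
  assumes "finite C"
  shows "colv R M j \<in> fv.span (colv R M ` C) \<longleftrightarrow> col_dep R C M j"
  unfolding span_image_explicit[OF assms] col_dep_def
  by (intro ex_cong1)
    (auto simp: fun_eq_iff sum_fun_at fscale_def colv_def mult.commute intro!: sum.neutral)

lemma dim_insert_finite:
  assumes "finite B"
  shows "fv.dim (insert a B) = (if a \<in> fv.span B then fv.dim B else Suc (fv.dim B))"
proof (cases "a \<in> fv.span B")
  case True
  then show ?thesis using fv.span_eq_dim[OF fv.span_redundant[OF True]] by simp
next
  case False
  obtain D where D: "D \<subseteq> B" "fv.independent D" "B \<subseteq> fv.span D" "card D = fv.dim B"
    using fv.basis_exists by blast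
  have fin: "finite D" using D(1) assms finite_subset by blast
  have sp: "fv.span D = fv.span B"
    using fv.span_mono[OF D(1)] fv.span_minimal[OF D(3)] by (simp add: subset_antisym)
  have "a \<notin> D" using False D(1) fv.span_base by blast
  have "fv.independent (insert a D)"
    using False sp D(2) fv.independent_insertI by blast
  moreover have "fv.span (insert a D) = fv.span (insert a B)"
    using sp by (simp add: fv.span_insert)
  ultimately have "fv.dim (insert a B) = card (insert a D)"
    using fv.dim_eq_card by metis
  then show ?thesis using False fin \<open>a \<notin> D\<close> D(4) by simp
qed

section \<open>Rank growth by one column or row, factorizations and transposition\<close>

lemma rk_empty_cols [simp]: "rk R {} M = 0"
  unfolding rk_def using fv.dim_eq_card_independent[OF fv.independent_empty] by simp

lemma rk_insert_col:
  assumes "finite C"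
  shows "rk R (insert j C) M = (if col_dep R C M j then rk R C M else Suc (rk R C M))"
  using dim_insert_finite[of "colv R M ` C" "colv R M j"] colv_in_span_iff[OF assms, of R M j] assms
  by (simp add: rk_def)

text \<open>Rank factorization: the columns of \<open>P\<close> are a basis of the column space and
  \<open>Q\<close> holds the coordinates. Together with the converse bound
  \<open>rk_le_factor\<close> this describes the rank symmetrically in rows and columns.\<close>

lemma rk_factor:
  assumes "finite C"
  shows "\<exists>P Q. \<forall>i\<in>R. \<forall>j\<in>C. M i j = (\<Sum>l<rk R C M. P i l * Q l j)"
proof -
  obtain D where D: "D \<subseteq> colv R M ` C" "fv.independent D" "colv R M ` C \<subseteq> fv.span D"
    "card D = rk R C M"
    using fv.basis_exists unfolding rk_def by blast
  have fin: "finite D" using D(1) assms finite_subset by blast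
  obtain d where d: "bij_betw d {..<rk R C M} D"
    using ex_bij_betw_nat_finite[OF fin] D(4) by (auto simp: atLeast0LessThan)
  have "\<exists>q. colv R M j = (\<Sum>l<rk R C M. fscale (q l) (d l))" if "j \<in> C" for j
  proof -
    have "colv R M j \<in> fv.span (d ` {..<rk R C M})"
      using D(3) that d by (auto simp: bij_betw_def)
    then show ?thesis by (subst (asm) span_image_explicit) auto
  qed
  then obtain q where q: "\<And>j. j \<in> C \<Longrightarrow> colv R M j = (\<Sum>l<rk R C M. fscale (q j l) (d l))"
    by metis
  have "M i j = (\<Sum>l<rk R C M. d l i * q j l)" if "i \<in> R" "j \<in> C" for i j
    using fun_cong[OF q[OF that(2)], of i] that
    by (simp add: colv_def sum_fun_at fscale_def mult.commute)
  then show ?thesis by (intro exI[of _ "\<lambda>i l. d l i"] exI[of _ "\<lambda>l j. q j l"]) auto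
qed

lemma rk_le_factor:
  assumes "\<And>i j. i \<in> R \<Longrightarrow> j \<in> C \<Longrightarrow> M i j = (\<Sum>l<(k::nat). P i l * Q l j)"
  shows "rk R C M \<le> k"
proof -
  define p where "p l = (\<lambda>i. if i \<in> R then P i l else 0)" for l
  have "colv R M ` C \<subseteq> fv.span (p ` {..<k})"
  proof clarify
    fix j assume "j \<in> C"
    then have "colv R M j = (\<Sum>l<k. fscale (Q l j) (p l))"
      using assms by (auto simp: colv_def p_def fun_eq_iff sum_fun_at fscale_def mult.commute)
    then show "colv R M j \<in> fv.span (p ` {..<k})"
      by (subst span_image_explicit) auto
  qed
  then have "rk R C M \<le> card (p ` {..<k})"
    unfolding rk_def by (rule fv.dim_le_card) simp
  also have "\<dots> \<le> k" using card_image_le[of "{..<k}" p] by simp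
  finally show ?thesis .
qed

text \<open>Transposing a factorization exchanges its two factors.\<close>

lemma rk_transpose_le:
  assumes "finite C"
  shows "rk C R (\<lambda>i j. M j i) \<le> rk R C M"
proof -
  obtain P Q where PQ: "\<forall>i\<in>R. \<forall>j\<in>C. M i j = (\<Sum>l<rk R C M. P i l * Q l j)"
    using rk_factor[OF assms, of R M] by blast
  show ?thesis
  proof (rule rk_le_factor)
    fix i j assume "i \<in> C" "j \<in> R"
    then have "M j i = (\<Sum>l<rk R C M. P j l * Q l i)" using PQ by blast
    also have "\<dots> = (\<Sum>l<rk R C M. Q l i * P j l)" by (simp only: mult.commute)
    finally show "M j i = (\<Sum>l<rk R C M. Q l i * P j l)" .
  qed
qed

lemma rk_transpose:
  assumes "finite R" "finite C"
  shows "rk R C M = rk C R (\<lambda>i j. M j i)"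
  using rk_transpose_le[OF assms(1), of C "\<lambda>i j. M j i"] rk_transpose_le[OF assms(2), of R M]
  by (rule order_antisym)

lemma rk_insert_row:
  assumes "finite R" "finite C"
  shows "rk (insert i R) C M =
    (if col_dep C R (\<lambda>a b. M b a) i then rk R C M else Suc (rk R C M))"
  using rk_insert_col[OF assms(1), of C i "\<lambda>a b. M b a"]
  unfolding rk_transpose[OF assms, of M] rk_transpose[OF finite.insertI[OF assms(1)] assms(2), of i M] .

text \<open>Bridge between the rank of the enumerated matrix and the dimension of a span of
  functions: linear dependence is carried in both directions along an injective linear map from
  vectors to functions.\<close>

lemma rank_on_eq_rk:
  assumes "finite S"
  shows "rank_on S M = rk S S M"
proof -
  define n where "n = card S"
  define e where "e = enum_of S"
  define A where "A = mat n n (\<lambda>(i, j). M (e i) (e j))"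
  have bij: "bij_betw e {..<n} S"
    unfolding e_def enum_of_def n_def
    using someI_ex[OF ex_bij_betw_nat_finite[OF assms]] by (simp add: atLeast0LessThan)
  interpret vec_space "TYPE('b)" n .
  define ie where "ie = the_inv_into {..<n} e"
  have ie: "ie i < n" "e (ie i) = i" if "i \<in> S" for i
    using that bij the_inv_into_into[of e "{..<n}" i] f_the_inv_into_f[of e "{..<n}" i]
    by (auto simp: ie_def bij_betw_def)
  have ie2: "ie (e k) = k" if "k < n" for k
    using that bij by (simp add: ie_def bij_betw_def the_inv_into_f_f)
  have eS: "e k \<in> S" if "k < n" for k using bij that by (auto simp: bij_betw_def)
  \<comment> \<open>\<open>h\<close> reads a vector as a function on \<open>S\<close>, extended by
    0. It is linear, injective on \<open>carrier_vec n\<close>, and sends the columns of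
    \<open>A\<close> to the functions \<open>colv S M j\<close>.\<close>
  define h :: "'b vec \<Rightarrow> 'a \<Rightarrow> 'b" where "h v = (\<lambda>i. if i \<in> S then v $ ie i else 0)" for v
  have A: "A \<in> carrier_mat n n" by (simp add: A_def)
  have carr: "set (cols A) \<subseteq> carrier_vec n" using A cols_dim by blast
  have hinj: "inj_on h (carrier_vec n)"
  proof
    fix v w assume vw: "v \<in> carrier_vec n" "w \<in> carrier_vec n" "h v = h w"
    show "v = w"
    proof (rule eq_vecI)
      fix k assume "k < dim_vec w"
      then have "k < n" using vw by simp
      then show "v $ k = w $ k"
        using fun_cong[OF vw(3), of "e k"] by (simp add: h_def eS ie2)
    qed (use vw in auto)
  qed
  have hcols: "h ` set (cols A) = colv S M ` S"
  proof -
    have hc: "h (col A j) = colv S M (e j)" if "j < n" for j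
      using that ie by (auto simp: h_def colv_def fun_eq_iff A_def)
    have "h ` set (cols A) = (\<lambda>j. h (col A j)) ` {..<n}"
      using A by (auto simp: cols_def)
    also have "\<dots> = colv S M ` e ` {..<n}" using hc by (auto simp: image_iff)
    finally show ?thesis using bij by (simp add: bij_betw_def)
  qed
  have dep: "lin_dep T \<longleftrightarrow> fv.dependent (h ` T)" if T: "T \<subseteq> carrier_vec n" "finite T" for T
  proof
    assume "lin_dep T"
    then obtain B a v where B: "finite B" "B \<subseteq> T" "lincomb a B = 0\<^sub>v n" "v \<in> B" "a v \<noteq> 0"
      unfolding lin_dep_def by auto
    have inj: "inj_on h B" using hinj B(2) T(1) inj_on_subset by blast
    define u where "u = a \<circ> the_inv_into B h"
    have u: "u (h w) = a w" if "w \<in> B" for w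
      using that inj by (simp add: u_def the_inv_into_f_f)
    have "(\<Sum>w\<in>h ` B. fscale (u w) w) = (\<Sum>w\<in>B. fscale (a w) (h w))"
      using inj by (simp add: sum.reindex u)
    also have "\<dots> = 0"
    proof
      fix i
      show "(\<Sum>w\<in>B. fscale (a w) (h w)) i = 0 i"
      proof (cases "i \<in> S")
        case True
        have "(\<Sum>w\<in>B. fscale (a w) (h w)) i = lincomb a B $ ie i"
          using lincomb_index[OF ie(1)[OF True], of B a] B T True
          by (simp add: sum_fun_at fscale_def h_def)
        then show ?thesis using B(3) ie(1)[OF True] by simp
      qed (simp add: sum_fun_at fscale_def h_def)
    qed
    finally have "(\<Sum>w\<in>h ` B. fscale (u w) w) = 0" .
    then show "fv.dependent (h ` T)"
      unfolding fv.dependent_explicit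
      using B u by (intro exI[of _ "h ` B"] exI[of _ u]) auto
  next
    assume "fv.dependent (h ` T)"
    then obtain u v where u: "(\<Sum>w\<in>h ` T. fscale (u w) w) = 0" "v \<in> T" "u (h v) \<noteq> 0"
      using T(2) by (auto simp: fv.dependent_finite)
    have inj: "inj_on h T" using hinj T(1) inj_on_subset by blast
    have z: "(\<Sum>w\<in>T. fscale (u (h w)) (h w)) = 0"
      using u(1) inj by (simp add: sum.reindex)
    have "lincomb (u \<circ> h) T = 0\<^sub>v n"
    proof (rule eq_vecI)
      fix k assume "k < dim_vec (0\<^sub>v n)"
      then have k: "k < n" by simp
      have "lincomb (u \<circ> h) T $ k = (\<Sum>w\<in>T. fscale (u (h w)) (h w)) (e k)"
        using lincomb_index[OF k T(1)] eS[OF k] ie2[OF k]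
        by (simp add: sum_fun_at fscale_def h_def)
      then show "lincomb (u \<circ> h) T $ k = 0\<^sub>v n $ k" using z k by simp
    qed (use lincomb_dim[OF T(2,1)] in auto)
    then show "lin_dep T"
      unfolding lin_dep_def using T u by (intro exI[of _ T] exI[of _ "u \<circ> h"] exI[of _ v]) auto
  qed
  have "lin_indpt {}" by (simp add: lin_dep_def)
  \<comment> \<open>The size of a maximal independent set of columns is the matrix rank; its image
    under \<open>h\<close> will be a basis of the span of all \<open>colv S M j\<close>.\<close>
  then obtain T where mx: "maximal T (\<lambda>T. T \<subseteq> set (cols A) \<and> lin_indpt T)"
    using maximal_exists_superset[of "set (cols A)" "\<lambda>T. T \<subseteq> set (cols A) \<and> lin_indpt T" "{}"]
    by auto
  then have T: "T \<subseteq> set (cols A)" "lin_indpt T" by (auto simp: maximal_def)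
  have finT: "finite T" using T(1) finite_subset by blast
  have Tc: "T \<subseteq> carrier_vec n" using T carr by blast
  have "rank_on S M = card T"
    using rank_card_indpt[OF A mx] unfolding rank_on_def A_def e_def n_def by simp
  also have "\<dots> = card (h ` T)" using hinj Tc by (metis card_image inj_on_subset)
  also have "\<dots> = rk S S M"
    unfolding rk_def hcols[symmetric]
  proof (rule fv.basis_card_eq_dim)
    show "h ` T \<subseteq> h ` set (cols A)" using T by blast
    show ind: "fv.independent (h ` T)" using T dep[OF Tc finT] by blast
    show "h ` set (cols A) \<subseteq> fv.span (h ` T)"
    proof clarify
      fix v assume v: "v \<in> set (cols A)"
      show "h v \<in> fv.span (h ` T)"
      proof (rule ccontr)
        assume not: "h v \<notin> fv.span (h ` T)"
        then have "fv.independent (h ` insert v T)"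
          using ind fv.independent_insertI by auto
        then have "lin_indpt (insert v T)"
          using dep[of "insert v T"] v carr Tc finT by auto
        then have "insert v T = T" using mx v T unfolding maximal_def by blast
        then show False using not fv.span_base by blast
      qed
    qed
  qed
  finally show ?thesis .
qed


section \<open>Reindexing and monotonicity\<close>

lemma rk_cong:
  assumes "\<And>i j. i \<in> R \<Longrightarrow> j \<in> C \<Longrightarrow> M i j = N i j"
  shows "rk R C M = rk R C N"
proof -
  have "colv R M ` C = colv R N ` C"
    using assms by (intro image_cong) (auto simp: colv_def fun_eq_iff)
  then show ?thesis by (simp add: rk_def)
qed

lemma rk_image_cols: "rk R (h ` C) M = rk R C (\<lambda>i c. M i (h c))"
  by (simp add: rk_def colv_def image_image)

lemma rk_image:
  assumes "finite S"
  shows "rk (h ` S) (h ` S) M = rk S S (\<lambda>i j. M (h i) (h j))"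
proof -
  have "rk (h ` S) (h ` S) M = rk (h ` S) S (\<lambda>i c. M i (h c))"
    by (rule rk_image_cols)
  also have "\<dots> = rk S (h ` S) (\<lambda>c i. M i (h c))"
    by (rule rk_transpose) (use assms in auto)
  also have "\<dots> = rk S S (\<lambda>c i. M (h i) (h c))"
    by (rule rk_image_cols)
  also have "\<dots> = rk S S (\<lambda>i j. M (h i) (h j))"
    by (rule rk_transpose[symmetric]) (use assms in auto)
  finally show ?thesis .
qed

lemma rk_insert_col_bounds:
  assumes "finite C"
  shows "rk R C M \<le> rk R (insert j C) M" "rk R (insert j C) M \<le> Suc (rk R C M)"
  by (simp_all add: rk_insert_col[OF assms])

lemma rk_insert_row_bounds:
  assumes "finite R" "finite C"
  shows "rk R C M \<le> rk (insert i R) C M" "rk (insert i R) C M \<le> Suc (rk R C M)"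
  by (simp_all add: rk_insert_row[OF assms])

lemma rk_mono_cols:
  assumes "finite C'" "C \<subseteq> C'"
  shows "rk R C M \<le> rk R C' M"
proof -
  have "rk R C M \<le> rk R (C \<union> D) M" if "finite D" for D
    using that
  proof (induction D rule: finite_induct)
    case (insert d D)
    then show ?case
      using rk_insert_col_bounds(1)[of "C \<union> D" R M d] finite_subset[OF assms(2,1)] by simp
  qed simp
  from this[of C'] show ?thesis using assms by (simp add: Un_absorb1)
qed

lemma rk_mono:
  assumes "finite S" "T \<subseteq> S"
  shows "rk T T M \<le> rk S S M"
proof -
  have fin: "finite T" using assms finite_subset by blast
  have "rk T T M \<le> rk T S M" using assms by (rule rk_mono_cols)
  also have "\<dots> = rk S T (\<lambda>i j. M j i)" using fin assms by (intro rk_transpose)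
  also have "\<dots> \<le> rk S S (\<lambda>i j. M j i)" using assms by (rule rk_mono_cols)
  also have "\<dots> = rk S S M" using assms by (intro rk_transpose[symmetric])
  finally show ?thesis .
qed

section \<open>Adding or deleting one index: jumps by 2, kernel vectors and perturbations\<close>

lemma rk_insert_le:
  assumes "finite S"
  shows "rk (insert v S) (insert v S) M \<le> rk S S M + 2"
  using rk_insert_row_bounds(2)[of S "insert v S" v M] rk_insert_col_bounds(2)[of S S v M] assms
  by simp

lemma rk_delete_le:
  assumes "finite S"
  shows "rk S S M \<le> rk (S - {v}) (S - {v}) M + 2"
  using rk_insert_le[of "S - {v}" v M] assms rk_mono[of "insert v S" S M]
  by (simp add: insert_absorb subset_insertI)

lemma col_dep_mono_rows: "col_dep R C M j \<Longrightarrow> R' \<subseteq> R \<Longrightarrow> col_dep R' C M j"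
  unfolding col_dep_def by blast

text \<open>The new column raises the rank by 1. The new row raises it again, since a row dependence
  in the enlarged matrix would restrict to one on the columns in \<open>S\<close>.\<close>

lemma rk_insert_add2:
  assumes "finite S" "\<not> col_dep S S M w" "\<not> col_dep S S (\<lambda>a b. M b a) w"
  shows "rk (insert w S) (insert w S) M = rk S S M + 2"
proof -
  have "\<not> col_dep (insert w S) S (\<lambda>a b. M b a) w"
    using assms(3) col_dep_mono_rows[of "insert w S" S _ w S] by blast
  then show ?thesis
    using assms rk_insert_col[of S S w M] rk_insert_row[of S "insert w S" w M] by simp
qed

text \<open>If the new column or the new row were dependent, it would contribute nothing and the
  other line at most 1.\<close>

lemma not_col_dep_of_rk_add2:
  assumes "finite S" "rk (insert w S) (insert w S) M = rk S S M + 2"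
  shows "\<not> col_dep S S M w" "\<not> col_dep S S (\<lambda>a b. M b a) w"
proof -
  show "\<not> col_dep S S M w"
    using assms rk_insert_row_bounds(2)[of S "insert w S" w M] rk_insert_col[of S S w M] by auto
  show "\<not> col_dep S S (\<lambda>a b. M b a) w"
    using assms rk_insert_col_bounds(2)[of S "insert w S" w M] rk_insert_row[of S S w M] by auto
qed

text \<open>Equal ranks leave no room for column \<open>v\<close> to be independent of the others,
  even with all rows present; its dependence, moved to one side, is a kernel vector with entry 1 at
  \<open>v\<close>.\<close>

lemma kernel_vector_of_rk_delete:
  assumes "finite S" "v \<in> S" "rk (S - {v}) (S - {v}) M = rk S S M"
  obtains x where "x v = 1" "\<And>i. i \<in> S \<Longrightarrow> (\<Sum>j\<in>S. M i j * x j) = 0"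
proof -
  have S: "S = insert v (S - {v})" using assms(2) by auto
  have "rk (S - {v}) (S - {v}) M \<le> rk S (S - {v}) M"
    using rk_insert_row_bounds(1)[of "S - {v}" "S - {v}" M v] assms(1) S by simp
  then have "\<not> Suc (rk S (S - {v}) M) = rk S S M" using assms(3) by simp
  then have "col_dep S (S - {v}) M v"
    using rk_insert_col[of "S - {v}" S v M] assms(1) S by (auto split: if_splits)
  then obtain x where x: "\<And>i. i \<in> S \<Longrightarrow> M i v = (\<Sum>c\<in>S - {v}. M i c * x c)"
    unfolding col_dep_def by blast
  show thesis
  proof (rule that[of "\<lambda>j. if j = v then 1 else - x j"])
    fix i assume i: "i \<in> S"
    have "(\<Sum>j\<in>S. M i j * (if j = v then 1 else - x j))
        = M i v + (\<Sum>j\<in>S - {v}. M i j * (if j = v then 1 else - x j))"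
      using assms(1,2) by (subst sum.remove[of S v]) auto
    also have "(\<Sum>j\<in>S - {v}. M i j * (if j = v then 1 else - x j)) = - (\<Sum>c\<in>S - {v}. M i c * x c)"
      unfolding sum_negf[symmetric] by (rule sum.cong) auto
    finally show "(\<Sum>j\<in>S. M i j * (if j = v then 1 else - x j)) = 0" using x[OF i] by simp
  qed simp
qed

text \<open>Dividing a kernel relation by a nonzero \<open>x v\<close> would express column
  \<open>v\<close> by the others, whereas a drop by 2 makes it independent of them.\<close>

lemma kernel_vector_zero_of_rk_delete:
  assumes "finite S" "v \<in> S" "rk S S M = rk (S - {v}) (S - {v}) M + 2"
    and x: "\<And>i. i \<in> S \<Longrightarrow> (\<Sum>j\<in>S. M i j * x j) = 0"
  shows "x v = 0"
proof (rule ccontr)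
  assume nz: "x v \<noteq> 0"
  have "\<not> col_dep (S - {v}) (S - {v}) M v"
    using not_col_dep_of_rk_add2(1)[of "S - {v}" v M] assms(1-3) by (simp add: insert_absorb)
  moreover have "col_dep (S - {v}) (S - {v}) M v"
  proof (rule col_depI)
    fix i assume that: "i \<in> S - {v}"
    have "M i v * x v + (\<Sum>c\<in>S - {v}. M i c * x c) = 0"
      using x[of i] that sum.remove[OF assms(1,2), of "\<lambda>j. M i j * x j"] by simp
    then have "M i v = - (\<Sum>c\<in>S - {v}. M i c * x c) / x v"
      using nz by (simp add: field_simps eq_neg_iff_add_eq_0)
    also have "\<dots> = (\<Sum>c\<in>S - {v}. M i c * (- x c / x v))"
      by (simp add: sum_divide_distrib sum_negf[symmetric])
    finally show "M i v = (\<Sum>c\<in>S - {v}. M i c * (- x c / x v))" .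
  qed
  ultimately show False by blast
qed

text \<open>Suppose column \<open>w\<close> were a combination of the others with coefficients
  \<open>x\<close> on the rows other than \<open>w\<close>. Pairing this relation with
  \<open>z\<close> and using symmetry gives 1 on one side (row \<open>w\<close> of
  \<open>M z\<close>) and 0 on the other (the remaining rows).\<close>

lemma rk_delete_of_solution:
  fixes M :: "'a \<Rightarrow> 'a \<Rightarrow> 'b::field"
  assumes fin: "finite S" and w: "w \<in> S" and sym: "\<And>i j. M i j = M j i" and zw: "z w = 0"
    and z: "\<And>i. i \<in> S \<Longrightarrow> (\<Sum>j\<in>S. M i j * z j) = (if i = w then 1 else 0)"
  shows "rk S S M = rk (S - {w}) (S - {w}) M + 2"
proof -
  have "\<not> col_dep (S - {w}) (S - {w}) M w"
  proof
    assume "col_dep (S - {w}) (S - {w}) M w"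
    then obtain x where x: "\<And>i. i \<in> S - {w} \<Longrightarrow> M i w = (\<Sum>c\<in>S - {w}. M i c * x c)"
      unfolding col_dep_def by blast
    have z': "(\<Sum>j\<in>S - {w}. M i j * z j) = (if i = w then 1 else 0)" if "i \<in> S" for i
      using z[OF that] zw sum.remove[OF fin w, of "\<lambda>j. M i j * z j"] by simp
    have "1 = (\<Sum>i\<in>S - {w}. z i * M i w)"
      using z'[OF w] sym by (simp add: mult.commute)
    also have "\<dots> = (\<Sum>i\<in>S - {w}. \<Sum>c\<in>S - {w}. z i * (M i c * x c))"
      using x by (intro sum.cong) (auto simp: sum_distrib_left)
    also have "\<dots> = (\<Sum>c\<in>S - {w}. \<Sum>i\<in>S - {w}. z i * (M i c * x c))"
      by (rule sum.swap)
    also have "\<dots> = (\<Sum>c\<in>S - {w}. x c * (\<Sum>i\<in>S - {w}. M c i * z i))"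
      using sym by (intro sum.cong) (auto simp: sum_distrib_left mult_ac)
    also have "\<dots> = 0" using z' by (intro sum.neutral) auto
    finally show False by simp
  qed
  moreover have "(\<lambda>a b. M b a) = M" using sym by (auto simp: fun_eq_iff)
  ultimately have "rk (insert w (S - {w})) (insert w (S - {w})) M = rk (S - {w}) (S - {w}) M + 2"
    using fin by (intro rk_insert_add2) simp_all
  then show ?thesis using w by (simp add: insert_absorb)
qed

text \<open>Append the unit vector at \<open>v\<close> as an extra column, indexed by
  \<open>None\<close>. Once row \<open>v\<close> is gone this column is zero, so removing row
  \<open>v\<close> and then column \<open>v\<close> bounds the rank of the extended matrix by
  \<open>rk S S M\<close>; hence the extra column is dependent.\<close>

lemma unit_vector_in_columns:
  fixes M :: "'a \<Rightarrow> 'a \<Rightarrow> 'b::field"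
  assumes fin: "finite S" and v: "v \<in> S" and rk: "rk S S M = rk (S - {v}) (S - {v}) M + 2"
  obtains z where "\<And>i. i \<in> S \<Longrightarrow> (\<Sum>j\<in>S. M i j * z j) = (if i = v then 1 else 0)"
proof -
  define N :: "'a \<Rightarrow> 'a option \<Rightarrow> 'b" where
    "N i c = (case c of None \<Rightarrow> (if i = v then 1 else 0) | Some d \<Rightarrow> M i d)" for i c
  have N: "rk R (Some ` S) N = rk R S M" for R by (simp add: rk_image_cols N_def)
  have "col_dep S (Some ` S) N None"
  proof (rule ccontr)
    assume "\<not> col_dep S (Some ` S) N None"
    then have "Suc (rk S S M) = rk S (insert None (Some ` S)) N"
      using fin N by (simp add: rk_insert_col)
    also have "\<dots> \<le> Suc (rk (S - {v}) (insert None (Some ` S)) N)"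
      using rk_insert_row_bounds(2)[of "S - {v}" "insert None (Some ` S)" v N] fin v
      by (simp add: insert_absorb)
    also have "col_dep (S - {v}) (Some ` S) N None"
      unfolding col_dep_def by (rule exI[of _ "\<lambda>_. 0"]) (simp add: N_def)
    then have "rk (S - {v}) (insert None (Some ` S)) N = rk (S - {v}) S M"
      using fin N by (simp add: rk_insert_col)
    also have "\<dots> \<le> Suc (rk (S - {v}) (S - {v}) M)"
      using rk_insert_col_bounds(2)[of "S - {v}" "S - {v}" v M] fin v by (simp add: insert_absorb)
    finally show False using rk by simp
  qed
  then obtain x where "\<And>i. i \<in> S \<Longrightarrow> N i None = (\<Sum>c\<in>Some ` S. N i c * x c)"
    unfolding col_dep_def by blast
  then have "(\<Sum>j\<in>S. M i j * x (Some j)) = (if i = v then 1 else 0)" if "i \<in> S" for i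
    using that by (simp add: sum.reindex N_def)
  then show thesis by (rule that)
qed

text \<open>Changing entry \<open>v\<close> of column \<open>w\<close> adds a multiple of the unit
  vector at \<open>v\<close>, which already lies in the column space on \<open>S\<close>.\<close>

lemma col_dep_perturb:
  fixes M N :: "'a \<Rightarrow> 'a \<Rightarrow> 'b::field"
  assumes fin: "finite S" and v: "v \<in> S" and rk: "rk S S M = rk (S - {v}) (S - {v}) M + 2"
    and "\<And>i j. i \<in> S \<Longrightarrow> j \<in> S \<Longrightarrow> N i j = M i j"
    and eq: "\<And>i. i \<in> S \<Longrightarrow> i \<noteq> v \<Longrightarrow> N i w = M i w"
    and dep: "col_dep S S N w"
  shows "col_dep S S M w"
proof -
  obtain z where z: "\<And>i. i \<in> S \<Longrightarrow> (\<Sum>j\<in>S. M i j * z j) = (if i = v then 1 else 0)"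
    using unit_vector_in_columns[OF fin v rk] by blast
  obtain x where x: "\<And>i. i \<in> S \<Longrightarrow> N i w = (\<Sum>c\<in>S. N i c * x c)"
    using dep unfolding col_dep_def by blast
  have "M i w = (\<Sum>c\<in>S. M i c * (x c + (M v w - N v w) * z c))" if i: "i \<in> S" for i
  proof -
    have "(\<Sum>c\<in>S. M i c * (x c + (M v w - N v w) * z c))
        = (\<Sum>c\<in>S. M i c * x c) + (M v w - N v w) * (\<Sum>c\<in>S. M i c * z c)"
      by (simp add: algebra_simps sum.distrib sum_distrib_left sum_subtractf)
    also have "(\<Sum>c\<in>S. M i c * x c) = N i w" using x[OF i] assms(4) i by simp
    finally show ?thesis using z[OF i] eq[OF i] by (cases "i = v") auto
  qed
  then show ?thesis by (rule col_depI)
qed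

text \<open>The entries between \<open>v\<close> and \<open>w\<close> may be altered without
  spoiling the jump by 2. This is what later allows an edge to be erased without changing the rank
  of the gain graph.\<close>

lemma rk_insert_add2_perturb:
  fixes M N :: "'a \<Rightarrow> 'a \<Rightarrow> 'b::field"
  assumes fin: "finite S" and v: "v \<in> S" and rk: "rk S S M = rk (S - {v}) (S - {v}) M + 2"
    and rkw: "rk (insert w S) (insert w S) M = rk S S M + 2"
    and eqS: "\<And>i j. i \<in> S \<Longrightarrow> j \<in> S \<Longrightarrow> N i j = M i j"
    and eqw: "\<And>i. i \<in> S \<Longrightarrow> i \<noteq> v \<Longrightarrow> N i w = M i w \<and> N w i = M w i"
  shows "rk (insert w S) (insert w S) N = rk S S M + 2"
proof -
  have tr: "rk S S (\<lambda>a b. M b a) = rk (S - {v}) (S - {v}) (\<lambda>a b. M b a) + 2"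
    using rk fin rk_transpose[of S S M] rk_transpose[of "S - {v}" "S - {v}" M] by simp
  note nd = not_col_dep_of_rk_add2[OF fin rkw]
  have "\<not> col_dep S S N w"
    using col_dep_perturb[OF fin v rk, of N w] eqS eqw nd(1) by blast
  moreover have "\<not> col_dep S S (\<lambda>a b. N b a) w"
    using col_dep_perturb[OF fin v tr, of "\<lambda>a b. N b a" w] eqS eqw nd(2) by blast
  moreover have "rk S S N = rk S S M" using eqS by (rule rk_cong)
  ultimately show ?thesis using rk_insert_add2[OF fin, of N w] by simp
qed

section \<open>Isolated vertices, pendant vertices and paths\<close>

lemma rk_insert_zero:
  assumes "finite S" "\<And>i. i \<in> insert u S \<Longrightarrow> M i u = 0 \<and> M u i = 0"
  shows "rk (insert u S) (insert u S) M = rk S S M"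
proof -
  have "col_dep S S M u" "col_dep (insert u S) S (\<lambda>a b. M b a) u"
    unfolding col_dep_def using assms(2) by (auto intro!: exI[of _ "\<lambda>_. 0"])
  then show ?thesis
    using assms rk_insert_col[of S S u M] rk_insert_row[of S "insert u S" u M] by simp
qed

lemma rk_Un_zero:
  assumes "finite Z" "finite S" "\<And>i u. i \<in> Z \<union> S \<Longrightarrow> u \<in> Z \<Longrightarrow> M i u = 0 \<and> M u i = 0"
  shows "rk (Z \<union> S) (Z \<union> S) M = rk S S M"
  using assms
proof (induction Z rule: finite_induct)
  case (insert u Z)
  then show ?case using rk_insert_zero[of "Z \<union> S" u M] by simp
qed simp

text \<open>Row \<open>u\<close> vanishes on \<open>insert u S\<close> but not at \<open>v\<close>,
  so column \<open>v\<close> is independent there; the same holds for rows. Afterwards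
  \<open>u\<close> contributes a zero line.\<close>

lemma rk_pendant:
  assumes "finite S" "M u v \<noteq> 0" "M v u \<noteq> 0" "\<And>i. i \<in> insert u S \<Longrightarrow> M i u = 0 \<and> M u i = 0"
  shows "rk (insert v (insert u S)) (insert v (insert u S)) M = rk S S M + 2"
proof -
  have "\<not> col_dep (insert u S) (insert u S) M v" "\<not> col_dep (insert u S) (insert u S) (\<lambda>a b. M b a) v"
    unfolding col_dep_def using assms(2-4) by auto
  then show ?thesis
    using rk_insert_add2[of "insert u S" M v] rk_insert_zero[of S u M] assms(1,4) by simp
qed

text \<open>Peel off the end of the path together with its neighbour: each such pair contributes 2,
  and a last single vertex contributes 0.\<close>

lemma rk_path:
  assumes "finite S" "distinct xs" "set xs \<inter> S = {}"
    and "\<And>i s. i \<in> set xs \<Longrightarrow> s \<in> S \<Longrightarrow> M i s = 0 \<and> M s i = 0"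
    and "\<And>i j. i < length xs \<Longrightarrow> j < length xs \<Longrightarrow> M (xs ! i) (xs ! j) \<noteq> 0 \<longleftrightarrow> i = Suc j \<or> j = Suc i"
  shows "rk (set xs \<union> S) (set xs \<union> S) M = rk S S M + 2 * (length xs div 2)"
  using assms(2-)
proof (induction xs rule: induct_list012)
  case 1
  then show ?case by simp
next
  case (2 a)
  have "M a a = 0" using "2.prems"(4)[of 0 0] by auto
  then show ?case using "2.prems"(3) rk_insert_zero[of S a M] assms(1) by auto
next
  case (3 a b ys)
  let ?T = "set ys \<union> S"
  have ab: "M a b \<noteq> 0" "M b a \<noteq> 0" "M a a = 0"
    using "3.prems"(4)[of 0 1] "3.prems"(4)[of 1 0] "3.prems"(4)[of 0 0] by auto
  have "M y a = 0 \<and> M a y = 0" if y: "y \<in> set ys" for y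
  proof -
    obtain k where "k < length ys" "y = ys ! k" using y by (auto simp: in_set_conv_nth)
    then show ?thesis using "3.prems"(4)[of 0 "k + 2"] "3.prems"(4)[of "k + 2" 0] by auto
  qed
  then have z: "M i a = 0 \<and> M a i = 0" if "i \<in> insert a ?T" for i
    using that ab "3.prems"(3) by auto
  have "rk ?T ?T M = rk S S M + 2 * (length ys div 2)"
  proof (rule "3.IH"(1))
    fix i j assume "i < length ys" "j < length ys"
    then show "M (ys ! i) (ys ! j) \<noteq> 0 \<longleftrightarrow> i = Suc j \<or> j = Suc i"
      using "3.prems"(4)[of "i + 2" "j + 2"] by simp
  qed (use "3.prems" in auto)
  moreover have "set (a # b # ys) \<union> S = insert b (insert a ?T)" by auto
  ultimately show ?case
    using rk_pendant[of ?T M a b, OF _ ab(1,2) z] assms(1) by simp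
qed

section \<open>Diagonal scaling and extension of the field\<close>

lemma rk_scale:
  fixes M :: "'r \<Rightarrow> 'c \<Rightarrow> 'b::field"
  assumes "finite C" "\<And>i. f i \<noteq> 0" "\<And>j. g j \<noteq> 0"
  shows "rk R C (\<lambda>i j. f i * M i j * g j) = rk R C M"
proof -
  have le: "rk R C (\<lambda>i j. f i * M i j * g j) \<le> rk R C M" for f g and M :: "'r \<Rightarrow> 'c \<Rightarrow> 'b"
  proof -
    obtain P Q where PQ: "\<forall>i\<in>R. \<forall>j\<in>C. M i j = (\<Sum>l<rk R C M. P i l * Q l j)"
      using rk_factor[OF assms(1), of R M] by blast
    show ?thesis
    proof (rule rk_le_factor)
      fix i j assume "i \<in> R" "j \<in> C"
      then have "M i j = (\<Sum>l<rk R C M. P i l * Q l j)" using PQ by blast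
      then have "f i * M i j * g j = f i * (\<Sum>l<rk R C M. P i l * Q l j) * g j" by (rule arg_cong)
      also have "\<dots> = (\<Sum>l<rk R C M. (f i * P i l) * (Q l j * g j))"
        by (simp add: sum_distrib_left sum_distrib_right mult_ac)
      finally show "f i * M i j * g j = (\<Sum>l<rk R C M. (f i * P i l) * (Q l j * g j))" .
    qed
  qed
  \<comment> \<open>Scaling back by the inverses turns the one-sided bound into an equality.\<close>
  have "rk R C M = rk R C (\<lambda>i j. inverse (f i) * (f i * M i j * g j) * inverse (g j))"
    using assms by (intro rk_cong) (simp add: field_simps)
  also have "\<dots> \<le> rk R C (\<lambda>i j. f i * M i j * g j)"
    using le[of "\<lambda>i. inverse (f i)" "\<lambda>i j. f i * M i j * g j" "\<lambda>j. inverse (g j)"] .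
  finally show ?thesis using le[of f M g] by simp
qed

text \<open>A complex dependence between real columns yields a real one by taking real parts of the
  coefficients, so the two ranks grow at the same columns.\<close>

lemma rk_complex_of_real:
  assumes "finite C"
  shows "rk R C (\<lambda>i j. complex_of_real (M i j)) = rk R C M"
  using assms
proof (induction C rule: finite_induct)
  case (insert j C)
  have "col_dep R C (\<lambda>i j. complex_of_real (M i j)) j \<longleftrightarrow> col_dep R C M j"
  proof
    assume "col_dep R C (\<lambda>i j. complex_of_real (M i j)) j"
    then obtain x where x: "\<And>i. i \<in> R \<Longrightarrow> complex_of_real (M i j) = (\<Sum>c\<in>C. complex_of_real (M i c) * x c)"
      unfolding col_dep_def by blast
    have "M i j = (\<Sum>c\<in>C. M i c * Re (x c))" if "i \<in> R" for i
    proof -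
      have "Re (complex_of_real (M i j)) = (\<Sum>c\<in>C. Re (complex_of_real (M i c) * x c))"
        unfolding x[OF that] by (rule Re_sum)
      then show ?thesis by simp
    qed
    then show "col_dep R C M j" by (rule col_depI)
  next
    assume "col_dep R C M j"
    then obtain x where x: "\<And>i. i \<in> R \<Longrightarrow> M i j = (\<Sum>c\<in>C. M i c * x c)"
      unfolding col_dep_def by blast
    have "complex_of_real (M i j) = (\<Sum>c\<in>C. complex_of_real (M i c) * complex_of_real (x c))" if "i \<in> R" for i
      by (simp add: x[OF that])
    then show "col_dep R C (\<lambda>i j. complex_of_real (M i j)) j"
      by (rule col_depI)
  qed
  then show ?case using insert by (simp add: rk_insert_col)
qed simp

section \<open>Cyclomatic number, cycles and potentials\<close>

definition edel :: "('a \<Rightarrow> 'a \<Rightarrow> bool) \<Rightarrow> 'a \<Rightarrow> 'a \<Rightarrow> 'a \<Rightarrow> 'a \<Rightarrow> bool" where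
  "edel E u v = (\<lambda>a b. E a b \<and> {a, b} \<noteq> {u, v})"

text \<open>The relation itself is cleared at \<open>X\<close>, so that \<open>V - X\<close> with
  \<open>vdel E X\<close> is again a simple graph and no edge has an end outside the vertex
  set.\<close>

definition vdel :: "('a \<Rightarrow> 'a \<Rightarrow> bool) \<Rightarrow> 'a set \<Rightarrow> 'a \<Rightarrow> 'a \<Rightarrow> bool" where
  "vdel E X = (\<lambda>a b. E a b \<and> a \<notin> X \<and> b \<notin> X)"

lemma simple_graphD:
  assumes "simple_graph V E"
  shows "finite V" "E u v \<Longrightarrow> u \<in> V" "E u v \<Longrightarrow> v \<in> V" "E u v \<Longrightarrow> E v u" "E u v \<Longrightarrow> u \<noteq> v"
  using assms unfolding simple_graph_def by blast+

lemma simple_graph_edel: "simple_graph V E \<Longrightarrow> simple_graph V (edel E u v)"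
  unfolding simple_graph_def edel_def by (auto simp: insert_commute)

lemma simple_graph_vdel: "simple_graph V E \<Longrightarrow> simple_graph (V - X) (vdel E X)"
  unfolding simple_graph_def vdel_def by auto

lemma simple_graph_rtranclp_sym:
  assumes "simple_graph V E" "E\<^sup>*\<^sup>* u v"
  shows "E\<^sup>*\<^sup>* v u"
  using assms(2) by (induction) (auto intro: converse_rtranclp_into_rtranclp simple_graphD(4)[OF assms(1)])

lemma rtranclp_edel_le: "(edel E u v)\<^sup>*\<^sup>* a b \<Longrightarrow> E\<^sup>*\<^sup>* a b"
  by (rule rtranclp_mono[THEN predicate2D, of "edel E u v"]) (auto simp: edel_def)

section \<open>Components and cyclomatic number under deletion of edges and vertices\<close>

lemma components_simple_graph:
  assumes "simple_graph V E"
  shows "components V E = (\<lambda>v. {w. E\<^sup>*\<^sup>* v w}) ` V"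
proof -
  have "(\<lambda>x y. x \<in> V \<and> y \<in> V \<and> E x y) = E"
    using simple_graphD[OF assms] by blast
  then show ?thesis by (simp add: components_def)
qed

lemma finite_components: "finite V \<Longrightarrow> finite (components V E)"
  by (simp add: components_def)

lemma finite_edges: "finite V \<Longrightarrow> finite (edges V E)"
  by (rule finite_subset[of _ "Pow V"]) (auto simp: edges_def)

lemma card_edges_edel:
  assumes "simple_graph V E" "E u v"
  shows "Suc (card (edges V (edel E u v))) = card (edges V E)"
proof -
  have "edges V (edel E u v) = edges V E - {{u, v}}"
    by (auto simp: edges_def edel_def)
  moreover have "{u, v} \<in> edges V E"
    unfolding edges_def using assms(2) simple_graphD(2,3)[OF assms(1)] by blast
  ultimately show ?thesis
    using card_Suc_Diff1[OF finite_edges[OF simple_graphD(1)[OF assms(1)], of E]] by simp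
qed

text \<open>A walk either avoids the edge or reaches one of its ends before using it for the first
  time.\<close>

lemma rtranclp_edel_cases:
  assumes "simple_graph V E" "E\<^sup>*\<^sup>* x y"
  shows "(edel E u v)\<^sup>*\<^sup>* x y \<or> (edel E u v)\<^sup>*\<^sup>* x u \<or> (edel E u v)\<^sup>*\<^sup>* x v"
  using assms(2)
proof induction
  case (step y z)
  then show ?case
    by (cases "{y, z} = {u, v}")
      (auto simp: edel_def doubleton_eq_iff intro: rtranclp.rtrancl_into_rtrancl)
qed simp

lemma components_edel_connected:
  assumes G: "simple_graph V E" and "E u v" and con: "(edel E u v)\<^sup>*\<^sup>* u v"
  shows "components V (edel E u v) = components V E"
proof -
  let ?F = "edel E u v"
  have F: "simple_graph V ?F" using G by (rule simple_graph_edel)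
  have vu: "?F\<^sup>*\<^sup>* v u" using simple_graph_rtranclp_sym[OF F con] .
  have "?F\<^sup>*\<^sup>* x y" if "E\<^sup>*\<^sup>* x y" for x y
    using that
  proof induction
    case (step y z)
    have "?F\<^sup>*\<^sup>* y z"
      by (cases "{y, z} = {u, v}")
        (use step con vu in \<open>auto simp: edel_def doubleton_eq_iff\<close>)
    with step.IH show ?case by simp
  qed simp
  then have "?F\<^sup>*\<^sup>* = E\<^sup>*\<^sup>*" by (auto simp: fun_eq_iff dest: rtranclp_edel_le)
  then show ?thesis by (simp add: components_simple_graph[OF F] components_simple_graph[OF G])
qed

text \<open>Apart from the component of \<open>u\<close>, the components after the deletion map
  injectively to components before it.\<close>

lemma card_components_edel_le:
  assumes G: "simple_graph V E" and uv: "E u v"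
  shows "card (components V (edel E u v)) \<le> Suc (card (components V E))"
proof -
  let ?F = "edel E u v"
  define K where "K x = {w. E\<^sup>*\<^sup>* x w}" for x
  define L where "L x = {w. ?F\<^sup>*\<^sup>* x w}" for x
  have F: "simple_graph V ?F" using G by (rule simple_graph_edel)
  have fin: "finite V" using simple_graphD(1)[OF G] .
  have symF: "?F\<^sup>*\<^sup>* x y \<Longrightarrow> ?F\<^sup>*\<^sup>* y x" for x y using simple_graph_rtranclp_sym[OF F] .
  have symE: "E\<^sup>*\<^sup>* x y \<Longrightarrow> E\<^sup>*\<^sup>* y x" for x y using simple_graph_rtranclp_sym[OF G] .
  have Leq: "L x = L y" if "?F\<^sup>*\<^sup>* x y" for x y
    unfolding L_def using that symF[OF that] by (auto intro: rtranclp_trans)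
  have Keq: "K x = K y \<longleftrightarrow> E\<^sup>*\<^sup>* x y" for x y
    unfolding K_def using symE by (auto intro: rtranclp_trans)
  have LF: "L x = L y \<Longrightarrow> ?F\<^sup>*\<^sup>* x y" for x y unfolding L_def by auto
  \<comment> \<open>Two vertices joined in the full graph but cut off from \<open>u\<close> are
    still joined, or else both still reach \<open>v\<close>.\<close>
  have *: "L x = L y" if "K x = K y" "L x \<noteq> L u" "L y \<noteq> L u" for x y
  proof -
    have "E\<^sup>*\<^sup>* x y" "E\<^sup>*\<^sup>* y x" using that(1) Keq symE by auto
    then have "?F\<^sup>*\<^sup>* x y \<or> ?F\<^sup>*\<^sup>* x v" "?F\<^sup>*\<^sup>* y x \<or> ?F\<^sup>*\<^sup>* y v"
      using rtranclp_edel_cases[OF G] Leq that(2,3) by metis+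
    then show ?thesis using Leq symF by metis
  qed
  define g where "g c = K (SOME x. x \<in> V \<and> c = L x)" for c
  have g: "\<exists>x. x \<in> V \<and> c = L x \<and> g c = K x" if "c \<in> L ` V" for c
    using that someI_ex[of "\<lambda>x. x \<in> V \<and> c = L x"] unfolding g_def by blast
  have "inj_on g (L ` V - {L u})"
  proof
    fix c d assume c: "c \<in> L ` V - {L u}" and d: "d \<in> L ` V - {L u}" and eq: "g c = g d"
    obtain x where x: "c = L x" "g c = K x" using g c by blast
    obtain y where y: "d = L y" "g d = K y" using g d by blast
    show "c = d" using *[of x y] x y c d eq by auto
  qed
  moreover have "g ` (L ` V - {L u}) \<subseteq> K ` V" using g by blast
  ultimately have "card (L ` V - {L u}) \<le> card (K ` V)"
    using fin by (intro card_inj_on_le) auto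
  then have "card (L ` V) \<le> Suc (card (K ` V))"
    using card_Diff1_le[of "L ` V" "L u"] fin by (auto simp: card_Diff_singleton_if split: if_splits)
  then show ?thesis
    by (simp add: components_simple_graph[OF F] components_simple_graph[OF G] K_def L_def)
qed

lemma theta_edel_connected:
  assumes "simple_graph V E" "E u v" "(edel E u v)\<^sup>*\<^sup>* u v"
  shows "theta V (edel E u v) = theta V E - 1"
  using card_edges_edel[OF assms(1,2)] components_edel_connected[OF assms] by (simp add: theta_def)

lemma theta_edel_le:
  assumes "simple_graph V E" "E u v"
  shows "theta V (edel E u v) \<le> theta V E"
  using card_edges_edel[OF assms] card_components_edel_le[OF assms] by (simp add: theta_def)

lemma vdel_edel: "vdel (edel E v w) {v} = vdel E {v}"
  unfolding vdel_def edel_def by (intro ext) (auto simp: doubleton_eq_iff)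

text \<open>One vertex and one component disappear, and their contributions to \<open>theta\<close>
  cancel.\<close>

lemma theta_vdel_isolated:
  assumes G: "simple_graph V E" and v: "v \<in> V" and iso: "\<And>w. \<not> E v w"
  shows "theta (V - {v}) (vdel E {v}) = theta V E"
proof -
  have E: "vdel E {v} = E"
    unfolding vdel_def using iso simple_graphD(4)[OF G] by (intro ext) blast
  have G': "simple_graph (V - {v}) E" using simple_graph_vdel[OF G, of "{v}"] E by simp
  have "edges (V - {v}) E = edges V E"
  proof -
    have "u \<noteq> v \<and> w \<noteq> v" if "E u w" for u w using that iso simple_graphD(4)[OF G that] by auto
    then show ?thesis unfolding edges_def by blast
  qed
  moreover have "components V E = insert {w. E\<^sup>*\<^sup>* v w} (components (V - {v}) E)"
    using v by (auto simp: components_simple_graph[OF G] components_simple_graph[OF G'])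
  moreover have "{w. E\<^sup>*\<^sup>* v w} \<notin> components (V - {v}) E"
  proof
    assume "{w. E\<^sup>*\<^sup>* v w} \<in> components (V - {v}) E"
    then obtain x where "x \<noteq> v" "{w. E\<^sup>*\<^sup>* v w} = {w. E\<^sup>*\<^sup>* x w}"
      by (auto simp: components_simple_graph[OF G'])
    then have "E\<^sup>*\<^sup>* v x" by (metis mem_Collect_eq rtranclp.rtrancl_refl)
    then show False using iso \<open>x \<noteq> v\<close> by (auto elim: converse_rtranclpE)
  qed
  ultimately show ?thesis
    using E v simple_graphD(1)[OF G] finite_components[of "V - {v}" E] card_gt_0_iff[of V]
    by (auto simp: theta_def)
qed

text \<open>Delete the edges at \<open>v\<close> one by one, which never raises
  \<open>theta\<close>, until \<open>v\<close> is isolated.\<close>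

lemma theta_vdel_le:
  assumes "simple_graph V E" "v \<in> V"
  shows "theta (V - {v}) (vdel E {v}) \<le> theta V E"
  using assms
proof (induction "card (edges V E)" arbitrary: E rule: less_induct)
  case less
  show ?case
  proof (cases "\<exists>w. E v w")
    case True
    then obtain w where w: "E v w" by blast
    have "theta (V - {v}) (vdel (edel E v w) {v}) \<le> theta V (edel E v w)"
      using card_edges_edel[OF less.prems(1) w] simple_graph_edel[OF less.prems(1)] less.prems(2)
      by (intro less.hyps) auto
    then show ?thesis using theta_edel_le[OF less.prems(1) w] by (simp add: vdel_edel)
  next
    case False
    then show ?thesis using theta_vdel_isolated[OF less.prems] by simp
  qed
qed

lemma theta_nonneg:
  assumes "simple_graph V E"
  shows "0 \<le> theta V E"
  using assms
proof (induction "card V" arbitrary: V E)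
  case 0
  then have "V = {}" using simple_graphD(1) by fastforce
  then show ?case by (simp add: theta_def edges_def components_def)
next
  case (Suc n)
  then obtain v where v: "v \<in> V" by fastforce
  have "0 \<le> theta (V - {v}) (vdel E {v})"
    using Suc v simple_graph_vdel by (metis card_Diff_singleton diff_Suc_1)
  then show ?case using theta_vdel_le[OF Suc.prems v] by simp
qed

section \<open>Cycles as cyclic vertex lists\<close>

lemma is_cycle_listD:
  assumes "is_cycle_list V E xs"
  shows "length xs \<ge> 3" "distinct xs" "set xs \<subseteq> V"
    "i < length xs \<Longrightarrow> E (xs ! i) (xs ! ((i + 1) mod length xs))"
  using assms unfolding is_cycle_list_def by blast+

lemma is_cycle_list_rotate:
  assumes "is_cycle_list V E xs"
  shows "is_cycle_list V E (rotate k xs)"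
proof -
  note c = is_cycle_listD[OF assms]
  have "E (rotate k xs ! i) (rotate k xs ! ((i + 1) mod length xs))" if "i < length xs" for i
  proof -
    have "rotate k xs ! i = xs ! ((k + i) mod length xs)" using that by (rule nth_rotate)
    moreover have "rotate k xs ! ((i + 1) mod length xs) = xs ! (((k + i) mod length xs + 1) mod length xs)"
    proof -
      have "(i + 1) mod length xs < length xs" using that by (intro mod_less_divisor) auto
      then show ?thesis by (subst nth_rotate) (auto simp: mod_simps)
    qed
    moreover have "(k + i) mod length xs < length xs" using that by (intro mod_less_divisor) auto
    ultimately show ?thesis using c(4)[of "(k + i) mod length xs"] by simp
  qed
  then show ?thesis using c unfolding is_cycle_list_def by simp
qed

lemma cycle_edges_rotate:
  assumes "xs \<noteq> []"
  shows "cycle_edges (rotate k xs) = cycle_edges xs"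
proof -
  define n where "n = length xs"
  have n: "0 < n" using assms by (simp add: n_def)
  define e where "e i = {xs ! (i mod n), xs ! ((i + 1) mod n)}" for i
  have 1: "cycle_edges xs = e ` {..<n}"
    by (auto simp: cycle_edges_def e_def n_def)
  have "{rotate k xs ! i, rotate k xs ! ((i + 1) mod n)} = e (k + i)" if "i < n" for i
    using that n by (simp add: e_def n_def nth_rotate mod_simps)
  then have 2: "cycle_edges (rotate k xs) = (\<lambda>i. e (k + i)) ` {..<n}"
    by (auto simp: cycle_edges_def n_def)
  have em: "e (i mod n) = e i" for i by (simp add: e_def mod_simps)
  have "e ` {..<n} \<subseteq> (\<lambda>i. e (k + i)) ` {..<n}"
  proof clarify
    fix i assume "i < n"
    \<comment> \<open>This is \<open>i - k\<close> modulo \<open>n\<close>, written so that no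
      natural subtraction is truncated.\<close>
    let ?j = "(i + (n - k mod n)) mod n"
    have "(k + ?j) mod n = (k mod n + (i + (n - k mod n))) mod n" by (simp add: mod_simps)
    also have "k mod n + (i + (n - k mod n)) = i + n" using n mod_less_divisor[of n k] by linarith
    finally have "(k + ?j) mod n = i" using \<open>i < n\<close> by simp
    then have "e i = e (k + ?j)" using em[of "k + ?j"] by simp
    then show "e i \<in> (\<lambda>i. e (k + i)) ` {..<n}" using n by (intro image_eqI[of _ _ ?j]) auto
  qed
  moreover have "(\<lambda>i. e (k + i)) ` {..<n} \<subseteq> e ` {..<n}"
  proof clarify
    fix i
    have "e (k + i) = e ((k + i) mod n)" by (simp add: em)
    then show "e (k + i) \<in> e ` {..<n}" using n by (intro image_eqI[of _ _ "(k + i) mod n"]) auto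
  qed
  ultimately show ?thesis unfolding 1 2 by (rule equalityI[rotated])
qed

text \<open>Rotation makes the given edge the closing one, from the last entry back to the first;
  what remains is a path between its ends.\<close>

lemma cycle_edge_rotate_last:
  assumes "is_cycle_list V E xs" "e \<in> cycle_edges xs"
  obtains ys where "is_cycle_list V E ys" "set ys = set xs" "cycle_edges ys = cycle_edges xs"
    "length ys = length xs" "e = {ys ! (length ys - 1), ys ! 0}"
proof -
  note c = is_cycle_listD[OF assms(1)]
  obtain i where i: "i < length xs" "e = {xs ! i, xs ! ((i + 1) mod length xs)}"
    using assms(2) by (auto simp: cycle_edges_def)
  define ys where "ys = rotate (i + 1) xs"
  have len: "length ys = length xs" by (simp add: ys_def)
  have "ys ! 0 = xs ! ((i + 1) mod length xs)"
    using c(1) unfolding ys_def by (subst nth_rotate) auto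
  moreover have "ys ! (length ys - 1) = xs ! ((i + 1 + (length xs - 1)) mod length xs)"
    using c(1) unfolding len ys_def by (subst nth_rotate) auto
  moreover have "i + 1 + (length xs - 1) = i + length xs" using i(1) by simp
  then have "(i + 1 + (length xs - 1)) mod length xs = i" using i(1) by simp
  ultimately have "e = {ys ! (length ys - 1), ys ! 0}" using i(2) by simp
  moreover have "cycle_edges ys = cycle_edges xs"
    unfolding ys_def using c(1) by (intro cycle_edges_rotate) auto
  moreover have "is_cycle_list V E ys" "set ys = set xs"
    using is_cycle_list_rotate[OF assms(1)] by (simp_all only: ys_def set_rotate)
  ultimately show thesis using that len by blast
qed

text \<open>With the edge rotated to the closing position, the rest of the list joins its ends;
  distinctness of the entries shows that no other step uses the same edge.\<close>

lemma cycle_edge_connected: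
  assumes G: "simple_graph V E" and "is_cycle_list V E xs" "{u, v} \<in> cycle_edges xs"
  shows "(edel E u v)\<^sup>*\<^sup>* u v"
proof -
  obtain ys where ys: "is_cycle_list V E ys" "{u, v} = {ys ! (length ys - 1), ys ! 0}"
    using cycle_edge_rotate_last[OF assms(2,3)] by metis
  note c = is_cycle_listD[OF ys(1)]
  have "(edel E u v)\<^sup>*\<^sup>* (ys ! 0) (ys ! k)" if "k < length ys" for k
    using that
  proof (induction k)
    case (Suc k)
    have "E (ys ! k) (ys ! Suc k)" using c(4)[of k] Suc.prems by simp
    moreover have "{ys ! k, ys ! Suc k} \<noteq> {u, v}"
    proof
      assume "{ys ! k, ys ! Suc k} = {u, v}"
      then have "{ys ! k, ys ! Suc k} = {ys ! (length ys - 1), ys ! 0}" using ys(2) by simp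
      then show False
      proof (cases "ys ! k = ys ! 0")
        case True
        moreover have "0 < length ys" "k < length ys" using Suc.prems by auto
        ultimately have "k = 0" using nth_eq_iff_index_eq[OF c(2), of k 0] by blast
        moreover have "ys ! Suc k = ys ! (length ys - 1)"
          using True \<open>{ys ! k, ys ! Suc k} = {ys ! (length ys - 1), ys ! 0}\<close>
          by (auto simp: doubleton_eq_iff)
        moreover have "length ys - 1 < length ys" using c(1) by linarith
        ultimately show ?thesis
          using c(1) Suc.prems nth_eq_iff_index_eq[OF c(2), of "Suc k" "length ys - 1"] by simp
      next
        case False
        then have "ys ! Suc k = ys ! 0"
          using \<open>{ys ! k, ys ! Suc k} = {ys ! (length ys - 1), ys ! 0}\<close>
          by (auto simp: doubleton_eq_iff)
        moreover have "0 < length ys" using Suc.prems by linarith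
        ultimately show ?thesis using Suc.prems nth_eq_iff_index_eq[OF c(2), of "Suc k" 0] by simp
      qed
    qed
    ultimately have "edel E u v (ys ! k) (ys ! Suc k)" by (simp add: edel_def)
    then show ?case using Suc by (meson Suc_lessD rtranclp.rtrancl_into_rtrancl)
  qed simp
  from this[of "length ys - 1"] c(1) have "(edel E u v)\<^sup>*\<^sup>* (ys ! 0) (ys ! (length ys - 1))" by simp
  moreover have "(edel E u v)\<^sup>*\<^sup>* (ys ! (length ys - 1)) (ys ! 0)"
    using calculation simple_graph_rtranclp_sym[OF simple_graph_edel[OF G]] by blast
  ultimately show ?thesis using ys(2) by (auto simp: doubleton_eq_iff)
qed

lemma is_cycle_list_edel:
  "is_cycle_list V (edel E u v) xs \<longleftrightarrow> is_cycle_list V E xs \<and> {u, v} \<notin> cycle_edges xs"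
  unfolding is_cycle_list_def edel_def cycle_edges_def by (auto; blast)

lemma is_cycle_list_vdel:
  "is_cycle_list (V - X) (vdel E X) xs \<longleftrightarrow> is_cycle_list V E xs \<and> set xs \<inter> X = {}"
proof -
  have "vdel E X (xs ! i) (xs ! ((i + 1) mod length xs)) \<longleftrightarrow> E (xs ! i) (xs ! ((i + 1) mod length xs))"
    if "set xs \<inter> X = {}" "i < length xs" for i
  proof -
    have "(i + 1) mod length xs < length xs" using that(2) by (intro mod_less_divisor) auto
    then have "xs ! i \<in> set xs" "xs ! ((i + 1) mod length xs) \<in> set xs" using that(2) by auto
    then show ?thesis using that(1) by (auto simp: vdel_def)
  qed
  then show ?thesis unfolding is_cycle_list_def by auto
qed

lemma cycle_edges_Union:
  assumes "xs \<noteq> []"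
  shows "\<Union> (cycle_edges xs) = set xs"
proof -
  have "(i + 1) mod length xs < length xs" for i using assms by simp
  then have "\<Union> (cycle_edges xs) \<subseteq> set xs" by (auto simp: cycle_edges_def)
  moreover have "set xs \<subseteq> \<Union> (cycle_edges xs)"
  proof
    fix x assume "x \<in> set xs"
    then obtain i where "i < length xs" "x = xs ! i" by (auto simp: in_set_conv_nth)
    then have "x \<in> {xs ! i, xs ! ((i + 1) mod length xs)}"
      "{xs ! i, xs ! ((i + 1) mod length xs)} \<in> cycle_edges xs"
      by (auto simp: cycle_edges_def)
    then show "x \<in> \<Union> (cycle_edges xs)" by blast
  qed
  ultimately show ?thesis by (rule equalityI)
qed

lemma cycle_vertex_edge:
  assumes "is_cycle_list V E xs" "v \<in> set xs"
  obtains w where "{v, w} \<in> cycle_edges xs" "E v w"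
proof -
  obtain i where "i < length xs" "v = xs ! i" using assms(2) by (auto simp: in_set_conv_nth)
  then show thesis
    using is_cycle_listD(4)[OF assms(1)] by (intro that[of "xs ! ((i + 1) mod length xs)"]) (auto simp: cycle_edges_def)
qed

text \<open>Deleting a cycle edge at \<open>v\<close> already lowers \<open>theta\<close> by 1, and
  deleting \<open>v\<close> afterwards does not raise it.\<close>

lemma theta_vdel_cycle:
  assumes G: "simple_graph V E" and xs: "is_cycle_list V E xs" "v \<in> set xs"
  shows "theta (V - {v}) (vdel E {v}) \<le> theta V E - 1"
proof -
  obtain w where w: "{v, w} \<in> cycle_edges xs" "E v w" using cycle_vertex_edge[OF xs] .
  have v: "v \<in> V" using w(2) simple_graphD(2)[OF G] by blast
  have "theta V (edel E v w) = theta V E - 1"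
    using theta_edel_connected[OF G w(2) cycle_edge_connected[OF G xs(1) w(1)]] .
  moreover have "theta (V - {v}) (vdel (edel E v w) {v}) \<le> theta V (edel E v w)"
    using simple_graph_edel[OF G] v by (rule theta_vdel_le)
  ultimately show ?thesis by (simp add: vdel_edel)
qed

text \<open>Take an edge of the first cycle missing from the second, with an end \<open>v\<close> on
  both. Deleting it lowers \<open>theta\<close> by 1 and keeps the second cycle, so deleting
  \<open>v\<close> lowers \<open>theta\<close> once more.\<close>

lemma theta_vdel_two_cycles:
  assumes G: "simple_graph V E" and xs: "is_cycle_list V E xs" and ys: "is_cycle_list V E ys"
    and common: "set xs \<inter> set ys \<noteq> {}" and not_le: "\<not> cycle_edges xs \<subseteq> cycle_edges ys"
  shows "\<exists>v \<in> set xs. theta (V - {v}) (vdel E {v}) \<le> theta V E - 2"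
proof -
  \<comment> \<open>If there were no such edge, walking along \<open>xs\<close> from a common vertex
    would never leave the edges of \<open>ys\<close>.\<close>
  have "\<exists>v w. v \<in> set xs \<and> v \<in> set ys \<and> E v w \<and> {v, w} \<in> cycle_edges xs \<and> {v, w} \<notin> cycle_edges ys"
  proof (rule ccontr)
    assume none: "\<not> ?thesis"
    obtain a where a: "a \<in> set xs" "a \<in> set ys" using common by blast
    obtain k where k: "k < length xs" "xs ! k = a" using a(1) by (auto simp: in_set_conv_nth)
    define zs where "zs = rotate k xs"
    have zs: "is_cycle_list V E zs" "cycle_edges zs = cycle_edges xs" "set zs = set xs"
      unfolding zs_def
      using a(1) is_cycle_list_rotate[OF xs] cycle_edges_rotate[of xs k] by (force, force, simp)
    note c = is_cycle_listD[OF zs(1)]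
    have z0: "zs ! 0 = a" using k unfolding zs_def by (subst nth_rotate) auto
    have edge: "{zs ! i, zs ! ((i + 1) mod length zs)} \<in> cycle_edges ys"
      if "i < length zs" "zs ! i \<in> set ys" for i
    proof -
      have "{zs ! i, zs ! ((i + 1) mod length zs)} \<in> cycle_edges xs"
        unfolding zs(2)[symmetric] unfolding cycle_edges_def using that(1) by blast
      moreover have "zs ! i \<in> set xs" using nth_mem[OF that(1)] unfolding zs(3) .
      ultimately show ?thesis using none that(2) c(4)[OF that(1)] by blast
    qed
    have all: "zs ! i \<in> set ys" if "i < length zs" for i
      using that
    proof (induction i)
      case 0
      then show ?case using z0 a by simp
    next
      case (Suc i)
      have "{zs ! i, zs ! Suc i} \<in> cycle_edges ys" using edge[of i] Suc by simp
      moreover have "\<Union> (cycle_edges ys) = set ys"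
        using is_cycle_listD(1)[OF ys] by (intro cycle_edges_Union) auto
      ultimately show ?case by blast
    qed
    have "cycle_edges zs \<subseteq> cycle_edges ys"
      using edge all by (auto simp: cycle_edges_def[of zs])
    then show False using zs(2) not_le by simp
  qed
  then obtain v w where vw: "v \<in> set xs" "v \<in> set ys" "E v w" "{v, w} \<in> cycle_edges xs"
    "{v, w} \<notin> cycle_edges ys" by blast
  have "theta V (edel E v w) = theta V E - 1"
    using theta_edel_connected[OF G vw(3) cycle_edge_connected[OF G xs vw(4)]] .
  moreover have "theta (V - {v}) (vdel (edel E v w) {v}) \<le> theta V (edel E v w) - 1"
    using simple_graph_edel[OF G] _ vw(2)
    by (rule theta_vdel_cycle) (simp add: is_cycle_list_edel ys vw(5))
  ultimately show ?thesis using vw(1) by (intro bexI[of _ v]) (simp_all add: vdel_edel)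
qed

section \<open>Paths and the cycle through a non-bridge\<close>

lemma rtranclp_distinct_path:
  assumes "E\<^sup>*\<^sup>* u v"
  obtains ps where "ps \<noteq> []" "distinct ps" "successively E ps" "hd ps = u" "last ps = v"
proof -
  have "\<exists>ps. ps \<noteq> [] \<and> distinct ps \<and> successively E ps \<and> hd ps = u \<and> last ps = v"
    using assms
  proof induction
    case base
    show ?case by (rule exI[of _ "[u]"]) simp
  next
    case (step y z)
    then obtain ps where ps: "ps \<noteq> []" "distinct ps" "successively E ps" "hd ps = u" "last ps = y" by blast
    show ?case
    proof (cases "z \<in> set ps")
      \<comment> \<open>The walk has returned to a visited vertex; it is cut back to that
        visit.\<close>
      case True
      then obtain as bs where "ps = as @ z # bs" by (auto simp: in_set_conv_decomp)
      then show ?thesis using ps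
        by (intro exI[of _ "as @ [z]"]) (auto simp: successively_append_iff hd_append)
    next
      case False
      then show ?thesis using ps step(2)
        by (intro exI[of _ "ps @ [z]"]) (auto simp: successively_append_iff)
    qed
  qed
  then show thesis using that by blast
qed

lemma cycle_through_edge:
  assumes G: "simple_graph V E" and uv: "E u v" and con: "(edel E u v)\<^sup>*\<^sup>* u v"
  obtains ps where "is_cycle_list V E ps" "successively (edel E u v) ps" "hd ps = u" "last ps = v"
    "{u, v} \<in> cycle_edges ps"
proof -
  obtain ps where ps: "ps \<noteq> []" "distinct ps" "successively (edel E u v) ps" "hd ps = u" "last ps = v"
    using rtranclp_distinct_path[OF con] .
  have nuv: "u \<noteq> v" using simple_graphD(5)[OF G uv] .
  have h: "ps ! 0 = u" "ps ! (length ps - 1) = v" using ps by (auto simp: hd_conv_nth last_conv_nth)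
  have step: "edel E u v (ps ! i) (ps ! Suc i)" if "Suc i < length ps" for i
    using ps(3) that by (simp add: successively_conv_nth)
  have "length ps \<noteq> 1" "length ps \<noteq> 0" using h nuv ps(1) by auto
  \<comment> \<open>A path of two vertices would be the deleted edge itself.\<close>
  moreover have "length ps \<noteq> 2"
  proof
    assume "length ps = 2"
    then show False using step[of 0] h by (simp add: edel_def)
  qed
  ultimately have len: "length ps \<ge> 3" by linarith
  have adj: "E (ps ! i) (ps ! ((i + 1) mod length ps))" if "i < length ps" for i
  proof (cases "Suc i < length ps")
    case True
    then show ?thesis using step[of i] by (simp add: edel_def)
  next
    case False
    then have i: "i = length ps - 1" using that by linarith
    then have "i + 1 = length ps" using len by linarith
    then have "(i + 1) mod length ps = 0" by simp
    then show ?thesis using i h simple_graphD(4)[OF G uv] by simp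
  qed
  have "set ps \<subseteq> V"
  proof
    fix x assume "x \<in> set ps"
    then obtain i where "i < length ps" "x = ps ! i" by (auto simp: in_set_conv_nth)
    then show "x \<in> V" using simple_graphD(2)[OF G adj] by blast
  qed
  then have "is_cycle_list V E ps" using len ps(2) adj by (simp add: is_cycle_list_def)
  moreover have "{u, v} \<in> cycle_edges ps"
  proof -
    have "length ps - 1 + 1 = length ps" "length ps - 1 < length ps" using len by linarith+
    then have "{u, v} = {ps ! (length ps - 1), ps ! ((length ps - 1 + 1) mod length ps)}"
      using h by (simp only: mod_self) (rule insert_commute)
    then show ?thesis unfolding cycle_edges_def using \<open>length ps - 1 < length ps\<close> by blast
  qed
  ultimately show thesis using that ps by blast
qed

section \<open>Balanced gains and potentials\<close>

lemma successively_potential_prod: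
  fixes f :: "'a \<Rightarrow> 'b::field"
  assumes "successively F ps" "ps \<noteq> []" "\<And>x. f x \<noteq> 0" "\<And>a b. F a b \<Longrightarrow> g a b = f a / f b"
  shows "(\<Prod>i<length ps - 1. g (ps ! i) (ps ! Suc i)) = f (hd ps) / f (last ps)"
  using assms(1,2)
proof (induction ps rule: induct_list012)
  case (3 a b ps)
  have "(\<Prod>i<length (a # b # ps) - 1. g ((a # b # ps) ! i) ((a # b # ps) ! Suc i))
     = g a b * (\<Prod>i<length (b # ps) - 1. g ((b # ps) ! i) ((b # ps) ! Suc i))"
    by (simp add: prod.lessThan_Suc_shift del: prod.lessThan_Suc)
  also have "\<dots> = f a / f b * (f b / f (last (b # ps)))"
    using 3 assms(4) by simp
  finally show ?case using assms(3) by simp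
qed (use assms(3) in auto)

text \<open>A gain that is trivial on every cycle is a coboundary. It is applied to \<phi> on
  acyclic graphs and to the constant -1, where the potential is a 2-colouring by signs on each
  component.\<close>

lemma potential_exists:
  fixes g :: "'a \<Rightarrow> 'a \<Rightarrow> 'b::field"
  assumes "simple_graph V E"
    and "\<And>u v. E u v \<Longrightarrow> g u v * g v u = 1"
    and "\<And>xs. is_cycle_list V E xs \<Longrightarrow>
      (\<Prod>i<length xs. g (xs ! i) (xs ! ((i + 1) mod length xs))) = 1"
  shows "\<exists>f. (\<forall>v. f v \<noteq> 0) \<and> (\<forall>u v. E u v \<longrightarrow> g u v = f u / f v)"
  using assms
proof (induction "card (edges V E)" arbitrary: E rule: less_induct)
  case less
  note G = less.prems(1)
  show ?case
  proof (cases "\<exists>u v. E u v")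
    case False
    then show ?thesis by (intro exI[of _ "\<lambda>_. 1"]) auto
  next
    case True
    then obtain u v where uv: "E u v" by blast
    let ?F = "edel E u v"
    have F: "simple_graph V ?F" using G by (rule simple_graph_edel)
    have "\<exists>f. (\<forall>v. f v \<noteq> 0) \<and> (\<forall>a b. ?F a b \<longrightarrow> g a b = f a / f b)"
    proof (rule less.hyps)
      show "card (edges V ?F) < card (edges V E)" using card_edges_edel[OF G uv] by simp
      show "g a b * g b a = 1" if "?F a b" for a b using that less.prems(2) by (simp add: edel_def)
      show "(\<Prod>i<length xs. g (xs ! i) (xs ! ((i + 1) mod length xs))) = 1"
        if "is_cycle_list V ?F xs" for xs
        using that less.prems(3) by (simp add: is_cycle_list_edel)
    qed (rule F)
    then obtain f where f: "\<And>v. f v \<noteq> 0" "\<And>a b. ?F a b \<Longrightarrow> g a b = f a / f b" by blast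
    have gnz: "g v u \<noteq> 0" "g u v = 1 / g v u" "g u v \<noteq> 0"
      using less.prems(2)[OF uv] by (auto simp: eq_divide_eq)
    show ?thesis
    proof (cases "?F\<^sup>*\<^sup>* u v")
      case True
      obtain ps where ps: "is_cycle_list V E ps" "successively ?F ps" "hd ps = u" "last ps = v"
        using cycle_through_edge[OF G uv True] .
      note c = is_cycle_listD[OF ps(1)]
      obtain n where n: "length ps = Suc n" using c(1) by (cases "length ps") auto
      have ne: "ps \<noteq> []" using n by auto
      \<comment> \<open>The path part telescopes to \<open>f u / f v\<close>, so triviality on this
        cycle fixes the gain of the closing edge.\<close>
      have "1 = (\<Prod>i<n. g (ps ! i) (ps ! ((i + 1) mod Suc n))) * g (ps ! n) (ps ! 0)"
        using less.prems(3)[OF ps(1)] n by simp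
      also have "(\<Prod>i<n. g (ps ! i) (ps ! ((i + 1) mod Suc n))) = (\<Prod>i<n. g (ps ! i) (ps ! Suc i))"
        by (intro prod.cong) auto
      also have "\<dots> = f u / f v"
        using successively_potential_prod[OF ps(2) ne f(1), of g] f(2) ps(3,4) n by simp
      finally have "1 = f u / f v * g (ps ! n) (ps ! 0)" .
      moreover have "ps ! n = v" "ps ! 0 = u"
        using ps(3,4) n last_conv_nth[OF ne] hd_conv_nth[OF ne] by simp_all
      ultimately have vu: "g v u = f v / f u" using f(1)[of u] f(1)[of v] by (simp add: field_simps)
      moreover have "g u v = f u / f v" unfolding gnz(2) vu by simp
      ultimately have "\<forall>a b. E a b \<longrightarrow> g a b = f a / f b"
        using f(2) by (auto simp: edel_def doubleton_eq_iff)
      then show ?thesis using f(1) by blast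
    next
      case False
      \<comment> \<open>The edge is a bridge: rescaling \<open>f\<close> on the side of
        \<open>u\<close> keeps all other edges correct, and this factor makes \<open>u v\<close>
        correct too.\<close>
      define k where "k = g u v * f v / f u"
      define h where "h x = (if ?F\<^sup>*\<^sup>* u x then k * f x else f x)" for x
      have k: "k \<noteq> 0" using gnz f(1) by (simp add: k_def)
      have "g a b = h a / h b" if "?F a b" for a b
      proof -
        have "?F\<^sup>*\<^sup>* u a \<longleftrightarrow> ?F\<^sup>*\<^sup>* u b"
          using that simple_graphD(4)[OF F that] by (meson rtranclp.rtrancl_into_rtrancl)
        then show ?thesis using f(2)[OF that] k by (simp add: h_def)
      qed
      moreover have "g u v = h u / h v" using False f(1) by (simp add: h_def k_def)
      moreover have "g v u = h v / h u" using False f(1) gnz by (simp add: h_def k_def field_simps)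
      ultimately have "\<forall>a b. E a b \<longrightarrow> g a b = h a / h b"
        by (auto simp: edel_def doubleton_eq_iff)
      moreover have "\<forall>x. h x \<noteq> 0" using k f(1) by (simp add: h_def)
      ultimately show ?thesis by blast
    qed
  qed
qed

section \<open>Extremal gain graphs\<close>

lemma graph_rank_eq_rk: "finite V \<Longrightarrow> graph_rank V E = rk V V (adj E)"
  by (simp add: graph_rank_def rank_on_eq_rk)

lemma gain_rank_eq_rk: "finite V \<Longrightarrow> gain_rank V E \<phi> = rk V V (gain_adj E \<phi>)"
  by (simp add: gain_rank_def rank_on_eq_rk)

lemma graph_rank_vdel: "finite V \<Longrightarrow> graph_rank (V - X) (vdel E X) = rk (V - X) (V - X) (adj E)"
  unfolding graph_rank_eq_rk[OF finite_Diff] by (rule rk_cong) (simp add: adj_def vdel_def)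

lemma gain_rank_vdel:
  "finite V \<Longrightarrow> gain_rank (V - X) (vdel E X) \<phi> = rk (V - X) (V - X) (gain_adj E \<phi>)"
  unfolding gain_rank_eq_rk[OF finite_Diff] by (rule rk_cong) (simp add: gain_adj_def vdel_def)

lemma adj_sym: "simple_graph V E \<Longrightarrow> adj E u v = adj E v u"
  using simple_graphD(4) by (fastforce simp: adj_def)

lemma gain_graphD:
  assumes "gain_graph V E \<phi>"
  shows "simple_graph V E" "E u v \<Longrightarrow> cmod (\<phi> u v) = 1" "E u v \<Longrightarrow> \<phi> v u = cnj (\<phi> u v)"
    "E u v \<Longrightarrow> \<phi> u v * \<phi> v u = 1"
proof -
  show "simple_graph V E" "E u v \<Longrightarrow> cmod (\<phi> u v) = 1" "E u v \<Longrightarrow> \<phi> v u = cnj (\<phi> u v)"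
    using assms by (auto simp: gain_graph_def)
  then show "E u v \<Longrightarrow> \<phi> u v * \<phi> v u = 1"
    using complex_norm_square[of "\<phi> u v"] by simp
qed

lemma gain_graph_vdel: "gain_graph V E \<phi> \<Longrightarrow> gain_graph (V - X) (vdel E X) \<phi>"
  using simple_graph_vdel[of V E X] by (auto simp: gain_graph_def vdel_def)

lemma gain_graph_edel: "gain_graph V E \<phi> \<Longrightarrow> gain_graph V (edel E u v) \<phi>"
  using simple_graph_edel[of V E u v] by (auto simp: gain_graph_def edel_def)

text \<open>A potential \<open>f\<close> for the gains exhibits the gain matrix as the adjacency
  matrix conjugated by an invertible diagonal matrix.\<close>

lemma gain_rank_acyclic:
  assumes "gain_graph V E \<phi>" "\<And>xs. \<not> is_cycle_list V E xs"
  shows "gain_rank V E \<phi> = graph_rank V E"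
proof -
  have G: "simple_graph V E" using gain_graphD(1)[OF assms(1)] .
  have fin: "finite V" using simple_graphD(1)[OF G] .
  obtain f where f: "\<And>v. f v \<noteq> 0" "\<And>u v. E u v \<Longrightarrow> \<phi> u v = f u / f v"
    using potential_exists[OF G, of \<phi>] gain_graphD(4)[OF assms(1)] assms(2) by blast
  have "rk V V (gain_adj E \<phi>) = rk V V (\<lambda>i j. f i * complex_of_real (adj E i j) * inverse (f j))"
    by (rule rk_cong) (simp add: gain_adj_def adj_def f(2) divide_inverse)
  also have "\<dots> = rk V V (\<lambda>i j. complex_of_real (adj E i j))"
    using fin f(1) by (intro rk_scale) simp_all
  also have "\<dots> = rk V V (adj E)" using fin by (rule rk_complex_of_real)
  finally show ?thesis using fin by (simp add: gain_rank_eq_rk graph_rank_eq_rk)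
qed

text \<open>Deleting a vertex on a cycle costs at most 2 in the gain rank, does not raise the graph
  rank and lowers \<open>theta\<close> by at least 1; acyclic graphs start the induction.\<close>

lemma gain_rank_le:
  assumes "gain_graph V E \<phi>"
  shows "int (gain_rank V E \<phi>) \<le> int (graph_rank V E) + 2 * theta V E"
  using assms
proof (induction "card V" arbitrary: V E rule: less_induct)
  case less
  have G: "simple_graph V E" using gain_graphD(1)[OF less.prems] .
  have fin: "finite V" using simple_graphD(1)[OF G] .
  show ?case
  proof (cases "\<exists>xs. is_cycle_list V E xs")
    case False
    then show ?thesis using gain_rank_acyclic[OF less.prems] theta_nonneg[OF G] by simp
  next
    case True
    then obtain xs where xs: "is_cycle_list V E xs" by blast
    define v where "v = xs ! 0"
    have "0 < length xs" using is_cycle_listD(1)[OF xs] by linarith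
    then have v: "v \<in> set xs" unfolding v_def by (rule nth_mem)
    then have vV: "v \<in> V" using is_cycle_listD(3)[OF xs] by blast
    have "card (V - {v}) < card V" using vV fin by (rule card_Diff1_less[rotated])
    then have "int (gain_rank (V - {v}) (vdel E {v}) \<phi>)
        \<le> int (graph_rank (V - {v}) (vdel E {v})) + 2 * theta (V - {v}) (vdel E {v})"
      using gain_graph_vdel[OF less.prems] by (rule less.hyps)
    moreover have "gain_rank V E \<phi> \<le> gain_rank (V - {v}) (vdel E {v}) \<phi> + 2"
      using rk_delete_le[OF fin] by (simp add: gain_rank_vdel[OF fin] gain_rank_eq_rk[OF fin])
    moreover have "graph_rank (V - {v}) (vdel E {v}) \<le> graph_rank V E"
      using rk_mono[OF fin Diff_subset] by (simp add: graph_rank_vdel[OF fin] graph_rank_eq_rk[OF fin])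
    ultimately show ?thesis using theta_vdel_cycle[OF G xs v] by linarith
  qed
qed

section \<open>The equality case: disjoint cycles, bridges and chords\<close>

definition extremal :: "'a set \<Rightarrow> ('a \<Rightarrow> 'a \<Rightarrow> bool) \<Rightarrow> ('a \<Rightarrow> 'a \<Rightarrow> complex) \<Rightarrow> bool" where
  "extremal V E \<phi> \<longleftrightarrow> gain_graph V E \<phi>
     \<and> int (gain_rank V E \<phi>) = int (graph_rank V E) + 2 * theta V E"

lemma extremalD:
  assumes "extremal V E \<phi>"
  shows "gain_graph V E \<phi>" "simple_graph V E" "finite V"
    "int (gain_rank V E \<phi>) = int (graph_rank V E) + 2 * theta V E"
proof -
  show 1: "gain_graph V E \<phi>" "int (gain_rank V E \<phi>) = int (graph_rank V E) + 2 * theta V E"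
    using assms by (simp_all add: extremal_def)
  show 2: "simple_graph V E" using gain_graphD(1)[OF 1(1)] .
  show "finite V" using simple_graphD(1)[OF 2] .
qed

lemma extremalI:
  assumes "gain_graph V E \<phi>" "int (graph_rank V E) + 2 * theta V E \<le> int (gain_rank V E \<phi>)"
  shows "extremal V E \<phi>"
  using assms gain_rank_le[OF assms(1)] by (simp add: extremal_def)

text \<open>The bound for the graph without \<open>v\<close> and the three estimates of the deletion
  step add up to the assumed equality, so each of them is tight.\<close>

lemma extremal_vdel_cycle:
  assumes "extremal V E \<phi>" "is_cycle_list V E xs" "v \<in> set xs"
  shows "extremal (V - {v}) (vdel E {v}) \<phi>"
    "rk (V - {v}) (V - {v}) (adj E) = rk V V (adj E)"
    "rk V V (gain_adj E \<phi>) = rk (V - {v}) (V - {v}) (gain_adj E \<phi>) + 2"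
    "theta (V - {v}) (vdel E {v}) = theta V E - 1"
proof -
  note x = extremalD[OF assms(1)]
  have g: "gain_graph (V - {v}) (vdel E {v}) \<phi>" using gain_graph_vdel[OF x(1)] .
  have 1: "int (gain_rank (V - {v}) (vdel E {v}) \<phi>)
      \<le> int (graph_rank (V - {v}) (vdel E {v})) + 2 * theta (V - {v}) (vdel E {v})"
    using g by (rule gain_rank_le)
  have 2: "gain_rank V E \<phi> \<le> gain_rank (V - {v}) (vdel E {v}) \<phi> + 2"
    using rk_delete_le[OF x(3)] by (simp add: gain_rank_vdel[OF x(3)] gain_rank_eq_rk[OF x(3)])
  have 3: "graph_rank (V - {v}) (vdel E {v}) \<le> graph_rank V E"
    using rk_mono[OF x(3) Diff_subset] by (simp add: graph_rank_vdel[OF x(3)] graph_rank_eq_rk[OF x(3)])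
  have 4: "theta (V - {v}) (vdel E {v}) \<le> theta V E - 1"
    using theta_vdel_cycle[OF x(2) assms(2,3)] .
  show "extremal (V - {v}) (vdel E {v}) \<phi>"
    using g 1 2 3 4 x(4) by (intro extremalI) linarith+
  show "rk (V - {v}) (V - {v}) (adj E) = rk V V (adj E)"
    using 1 2 3 4 x(4) unfolding graph_rank_vdel[OF x(3)] graph_rank_eq_rk[OF x(3)] by linarith
  show "rk V V (gain_adj E \<phi>) = rk (V - {v}) (V - {v}) (gain_adj E \<phi>) + 2"
    using 1 2 3 4 x(4) unfolding gain_rank_vdel[OF x(3)] gain_rank_eq_rk[OF x(3)] by linarith
  show "theta (V - {v}) (vdel E {v}) = theta V E - 1" using 1 2 3 4 x(4) by linarith
qed

text \<open>Were one of two meeting cycles not contained in the other, deleting a suitable vertex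
  would lower \<open>theta\<close> by 2 instead of exactly 1.\<close>

lemma extremal_cycles_meet:
  assumes "extremal V E \<phi>" "is_cycle_list V E xs" "is_cycle_list V E ys" "v \<in> set xs" "v \<in> set ys"
  shows "cycle_edges xs = cycle_edges ys" "set xs = set ys"
proof -
  have sub: "cycle_edges as \<subseteq> cycle_edges bs"
    if c: "is_cycle_list V E as" "is_cycle_list V E bs" "v \<in> set as" "v \<in> set bs" for as bs
  proof (rule ccontr)
    assume "\<not> cycle_edges as \<subseteq> cycle_edges bs"
    then obtain a where "a \<in> set as" "theta (V - {a}) (vdel E {a}) \<le> theta V E - 2"
      using theta_vdel_two_cycles[OF extremalD(2)[OF assms(1)] c(1,2)] c(3,4) by blast
    then show False using extremal_vdel_cycle(4)[OF assms(1) c(1)] by force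
  qed
  show eq: "cycle_edges xs = cycle_edges ys"
    using sub[OF assms(2,3,4,5)] sub[OF assms(3,2,5,4)] by (rule subset_antisym)
  have "xs \<noteq> []" "ys \<noteq> []" using assms(4,5) by auto
  then show "set xs = set ys" using eq cycle_edges_Union by metis
qed

text \<open>Otherwise a cycle through the edge would meet \<open>xs\<close> in \<open>p\<close> and
  yet contain \<open>w\<close>.\<close>

lemma extremal_exit_bridge:
  assumes "extremal V E \<phi>" "is_cycle_list V E xs" "p \<in> set xs" "w \<notin> set xs" "E p w"
  shows "\<not> (edel E p w)\<^sup>*\<^sup>* p w"
proof
  assume con: "(edel E p w)\<^sup>*\<^sup>* p w"
  obtain ps where ps: "is_cycle_list V E ps" "{p, w} \<in> cycle_edges ps"
    using cycle_through_edge[OF extremalD(2)[OF assms(1)] assms(5) con] .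
  have "ps \<noteq> []" using is_cycle_listD(1)[OF ps(1)] by auto
  then have "p \<in> set ps" "w \<in> set ps" using ps(2) cycle_edges_Union[of ps] by blast+
  then show False using extremal_cycles_meet(2)[OF assms(1,2) ps(1) assms(3)] assms(4) by blast
qed

lemma cycle_list_connected:
  assumes "simple_graph V E" "is_cycle_list V E xs" "u \<in> set xs" "v \<in> set xs"
  shows "E\<^sup>*\<^sup>* u v"
proof -
  have "E\<^sup>*\<^sup>* (xs ! 0) (xs ! k)" if "k < length xs" for k
    using that
  proof (induction k)
    case (Suc k)
    have "E (xs ! k) (xs ! Suc k)" using is_cycle_listD(4)[OF assms(2), of k] Suc.prems by simp
    then show ?case using Suc by (simp add: rtranclp.rtrancl_into_rtrancl)
  qed simp
  then have "E\<^sup>*\<^sup>* (xs ! 0) x" if "x \<in> set xs" for x using that by (auto simp: in_set_conv_nth)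
  from this[OF assms(3)] this[OF assms(4)] show ?thesis
    using simple_graph_rtranclp_sym[OF assms(1)] by (meson rtranclp_trans)
qed

text \<open>The cycle survives deletion of a chord, so the chord would lie on another cycle through
  \<open>u\<close>.\<close>

lemma extremal_chordless:
  assumes "extremal V E \<phi>" "is_cycle_list V E xs" "u \<in> set xs" "v \<in> set xs" "E u v"
  shows "{u, v} \<in> cycle_edges xs"
proof (rule ccontr)
  assume not: "{u, v} \<notin> cycle_edges xs"
  note G = extremalD(2)[OF assms(1)]
  have "(edel E u v)\<^sup>*\<^sup>* u v"
    using simple_graph_edel[OF G] _ assms(3,4)
    by (rule cycle_list_connected) (simp add: is_cycle_list_edel assms(2) not)
  then obtain ps where ps: "is_cycle_list V E ps" "{u, v} \<in> cycle_edges ps"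
    using cycle_through_edge[OF G assms(5)] by metis
  have "ps \<noteq> []" using is_cycle_listD(1)[OF ps(1)] by auto
  then have "u \<in> set ps" using ps(2) cycle_edges_Union[of ps] by blast
  then show False using extremal_cycles_meet(1)[OF assms(1,2) ps(1) assms(3)] ps(2) not by blast
qed

text \<open>The sign function \<open>f\<close> has to alternate only on edges avoiding
  \<open>p\<close>, so the lemma can be applied before the cycle through \<open>p\<close> is known
  to be even.\<close>

lemma graph_rank_vdel_exit:
  assumes x: "extremal V E \<phi>" and xs: "is_cycle_list V E xs" "p \<in> set xs"
    and w: "w \<notin> set xs" "E p w"
    and f: "\<And>v. f v \<noteq> (0::real)" "\<And>a b. E a b \<Longrightarrow> a \<noteq> p \<Longrightarrow> b \<noteq> p \<Longrightarrow> f a = - f b"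
  shows "rk V V (adj E) = rk (V - {w}) (V - {w}) (adj E) + 2"
proof -
  note G = extremalD(2)[OF x] and fin = extremalD(3)[OF x]
  let ?F = "edel E p w"
  have F: "simple_graph V ?F" using simple_graph_edel[OF G] .
  define Y where "Y = {v. ?F\<^sup>*\<^sup>* w v}"
  have wY: "w \<in> Y" by (simp add: Y_def)
  have pY: "p \<notin> Y"
    using extremal_exit_bridge[OF x xs w] simple_graph_rtranclp_sym[OF F] unfolding Y_def by blast
  have pV: "p \<in> V" and wV: "w \<in> V" using simple_graphD(2,3)[OF G w(2)] by auto
  \<comment> \<open>The bridge is the only edge leaving the side \<open>Y\<close> of
    \<open>w\<close>.\<close>
  have cross: "a = w \<and> b = p" if "E a b" "a \<in> Y" "b \<notin> Y" for a b
  proof -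
    have "\<not> ?F a b" using that(2,3) by (auto simp: Y_def intro: rtranclp.rtrancl_into_rtrancl)
    then have "{a, b} = {p, w}" using that(1) by (simp add: edel_def)
    then show ?thesis using that(2) pY by (auto simp: doubleton_eq_iff)
  qed
  obtain k where k: "k p = 1" "\<And>i. i \<in> V \<Longrightarrow> (\<Sum>j\<in>V. adj E i j * k j) = 0"
    using kernel_vector_of_rk_delete[OF fin pV extremal_vdel_cycle(2)[OF x xs]] by blast
  \<comment> \<open>On \<open>Y\<close> the quotient \<open>f v / f w\<close> is 1 on the colour
    class of \<open>w\<close> and -1 on the other, so \<open>z\<close> is 0 on the former and
    \<open>- k\<close> on the latter.\<close>
  define z where "z v = (if v \<in> Y then (f v / f w - 1) * k v / 2 else 0)" for v
  have fY: "adj E i j * f j = - f i * adj E i j" if "i \<in> Y" "j \<in> Y" for i j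
    using f(2)[of i j] that pY by (cases "i = p"; cases "j = p") (auto simp: adj_def)
  \<comment> \<open>Multiplication by \<open>f\<close> anticommutes with the adjacency matrix inside
    \<open>Y\<close>, so the projection onto one class can be pulled out of the row sum with the
    classes exchanged.\<close>
  have zs: "(\<Sum>j\<in>V. adj E i j * z j) = (- f i / f w - 1) / 2 * (\<Sum>j\<in>V. if j \<in> Y then adj E i j * k j else 0)"
    if "i \<in> Y" for i
    unfolding sum_distrib_left
  proof (rule sum.cong)
    fix j assume "j \<in> V"
    show "adj E i j * z j = (- f i / f w - 1) / 2 * (if j \<in> Y then adj E i j * k j else 0)"
    proof (cases "j \<in> Y")
      case True
      have "adj E i j * z j = (adj E i j * f j / f w - adj E i j) * k j / 2"
        using True by (simp add: z_def algebra_simps)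
      also have "\<dots> = (- f i * adj E i j / f w - adj E i j) * k j / 2" using fY[OF that True] by simp
      also have "\<dots> = (- f i / f w - 1) / 2 * (adj E i j * k j)" by (simp add: algebra_simps)
      finally show ?thesis using True by simp
    qed (simp add: z_def)
  qed simp
  \<comment> \<open>Cutting the kernel vector off at the bridge removes only the term of
    \<open>p\<close> in row \<open>w\<close>, and \<open>k p = 1\<close>.\<close>
  have kY: "(\<Sum>j\<in>V. if j \<in> Y then adj E i j * k j else 0) = (if i = w then -1 else 0)"
    if i: "i \<in> Y" "i \<in> V" for i
  proof -
    have "(\<Sum>j\<in>V. if j \<in> Y then adj E i j * k j else 0)
        = (\<Sum>j\<in>V. adj E i j * k j - (if j = p \<and> i = w then 1 else 0))"
    proof (rule sum.cong)
      fix j assume "j \<in> V"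
      show "(if j \<in> Y then adj E i j * k j else 0) = adj E i j * k j - (if j = p \<and> i = w then 1 else 0)"
      proof (cases "j \<in> Y")
        case True
        then show ?thesis using pY by auto
      next
        case False
        have wp: "E w p" using simple_graphD(4)[OF G w(2)] .
        show ?thesis
        proof (cases "E i j")
          case True
          then have "i = w" "j = p" using cross i(1) False by blast+
          then show ?thesis using False k(1) wp by (simp add: adj_def)
        next
          case nE: False
          then have "\<not> (j = p \<and> i = w)" using wp by blast
          then show ?thesis using False nE by (simp add: adj_def)
        qed
      qed
    qed simp
    also have "\<dots> = - (\<Sum>j\<in>V. if j = p \<and> i = w then 1 else 0)"
      using k(2)[OF i(2)] by (simp add: sum_subtractf)
    finally show ?thesis using pV fin by (auto simp: if_distrib)
  qed
  show ?thesis
  proof (rule rk_delete_of_solution[OF fin wV])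
    show "adj E i j = adj E j i" for i j using adj_sym[OF G] .
    show zw: "z w = 0" using f(1)[of w] by (simp add: z_def)
    fix i assume iV: "i \<in> V"
    show "(\<Sum>j\<in>V. adj E i j * z j) = (if i = w then 1 else 0)"
    proof (cases "i \<in> Y")
      case True
      show ?thesis unfolding zs[OF True] kY[OF True iV] using f(1)[of w] by (cases "i = w") simp_all
    next
      case False
      \<comment> \<open>A row outside \<open>Y\<close> can see \<open>Y\<close> only through
        \<open>w\<close>, where \<open>z\<close> vanishes.\<close>
      have "adj E i j * z j = 0" for j
      proof (cases "E i j \<and> j \<in> Y")
        case True
        then have "j = w" using cross[of j i] simple_graphD(4)[OF G] False by blast
        then show ?thesis using zw by simp
      qed (auto simp: adj_def z_def)
      moreover have "i \<noteq> w" using False wY by blast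
      ultimately show ?thesis by simp
    qed
  qed
qed

text \<open>The graph rank drops by 2 at \<open>w\<close>, the gain rank by at most 2, and
  \<open>theta\<close> does not grow; with the general bound this forces equality for the graph
  without \<open>w\<close>. A vertex on a cycle would instead leave the graph rank
  unchanged.\<close>

lemma extremal_vdel_exit:
  assumes x: "extremal V E \<phi>" and xs: "is_cycle_list V E xs" "p \<in> set xs"
    and w: "w \<notin> set xs" "E p w"
    and f: "\<And>v. f v \<noteq> (0::real)" "\<And>a b. E a b \<Longrightarrow> a \<noteq> p \<Longrightarrow> b \<noteq> p \<Longrightarrow> f a = - f b"
  shows "extremal (V - {w}) (vdel E {w}) \<phi>"
    "\<not> (is_cycle_list V E ys \<and> w \<in> set ys)"
    "extremal V (edel E p w) \<phi>"
    "graph_rank V (edel E p w) = graph_rank V E"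
proof -
  note G = extremalD(2)[OF x] and fin = extremalD(3)[OF x]
  have pV: "p \<in> V" and wV: "w \<in> V" using simple_graphD(2,3)[OF G w(2)] by auto
  have rG: "rk V V (adj E) = rk (V - {w}) (V - {w}) (adj E) + 2"
    using graph_rank_vdel_exit[OF x xs w f] .
  have th: "theta (V - {w}) (vdel E {w}) \<le> theta V E" using theta_vdel_le[OF G wV] .
  have le: "rk V V (gain_adj E \<phi>) \<le> rk (V - {w}) (V - {w}) (gain_adj E \<phi>) + 2"
    using rk_delete_le[OF fin] .
  show xw: "extremal (V - {w}) (vdel E {w}) \<phi>"
    using gain_graph_vdel[OF extremalD(1)[OF x]] rG th le extremalD(4)[OF x]
    by (intro extremalI)
      (auto simp: graph_rank_vdel[OF fin] gain_rank_vdel[OF fin] graph_rank_eq_rk[OF fin] gain_rank_eq_rk[OF fin])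
  have rPhi: "rk V V (gain_adj E \<phi>) = rk (V - {w}) (V - {w}) (gain_adj E \<phi>) + 2"
    using rG th le extremalD(4)[OF x] extremalD(4)[OF xw]
    unfolding graph_rank_vdel[OF fin] gain_rank_vdel[OF fin] graph_rank_eq_rk[OF fin] gain_rank_eq_rk[OF fin]
    by linarith
  show "\<not> (is_cycle_list V E ys \<and> w \<in> set ys)"
    using extremal_vdel_cycle(2)[OF x, of ys w] rG by auto
  let ?V = "V - {w}"
  have "is_cycle_list ?V (vdel E {w}) xs" using xs(1) w(1) by (simp add: is_cycle_list_vdel)
  from extremal_vdel_cycle(3)[OF xw this xs(2)]
  \<comment> \<open>\<open>xs\<close> is still a cycle after \<open>w\<close> is deleted, so
    deleting \<open>p\<close> next lowers the gain rank by 2. This puts the unit vector at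
    \<open>p\<close> into the column space, and the entries of the edge \<open>p w\<close> may be
    erased.\<close>
  have rp: "rk ?V ?V (gain_adj (vdel E {w}) \<phi>) = rk (?V - {p}) (?V - {p}) (gain_adj (vdel E {w}) \<phi>) + 2" .
  have cg: "rk S S (gain_adj (vdel E {w}) \<phi>) = rk S S (gain_adj E \<phi>)" if "S \<subseteq> ?V" for S
    using that by (intro rk_cong) (auto simp: gain_adj_def vdel_def)
  have rp': "rk ?V ?V (gain_adj E \<phi>) = rk (?V - {p}) (?V - {p}) (gain_adj E \<phi>) + 2"
    using rp cg[of ?V] cg[of "?V - {p}"] by auto
  have nwp: "p \<noteq> w" using w(1) xs(2) by blast
  have "rk (insert w ?V) (insert w ?V) (gain_adj (edel E p w) \<phi>) = rk ?V ?V (gain_adj E \<phi>) + 2"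
  proof (rule rk_insert_add2_perturb[OF _ _ rp'])
    show "finite ?V" using fin by simp
    show "p \<in> ?V" using pV nwp by simp
    show "rk (insert w ?V) (insert w ?V) (gain_adj E \<phi>) = rk ?V ?V (gain_adj E \<phi>) + 2"
      using rPhi wV by (simp add: insert_absorb)
  qed (auto simp: gain_adj_def edel_def doubleton_eq_iff)
  then have re: "gain_rank V (edel E p w) \<phi> = gain_rank V E \<phi>"
    using rPhi wV by (simp add: gain_rank_eq_rk[OF fin] insert_absorb)
  \<comment> \<open>Without \<open>w\<close> the two adjacency matrices agree, which bounds the
    graph rank after the edge deletion by that of the graph without \<open>w\<close> plus 2.\<close>
  have "rk ?V ?V (adj (edel E p w)) = rk ?V ?V (adj E)"
    by (rule rk_cong) (auto simp: adj_def edel_def doubleton_eq_iff)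
  then have rge: "graph_rank V (edel E p w) \<le> graph_rank V E"
    using rk_delete_le[OF fin, of "adj (edel E p w)" w] rG by (simp add: graph_rank_eq_rk[OF fin])
  have the: "theta V (edel E p w) \<le> theta V E" using theta_edel_le[OF G w(2)] .
  show xe: "extremal V (edel E p w) \<phi>"
    using gain_graph_edel[OF extremalD(1)[OF x]] re rge the extremalD(4)[OF x]
    by (intro extremalI) simp_all
  show "graph_rank V (edel E p w) = graph_rank V E"
    using extremalD(4)[OF xe] extremalD(4)[OF x] re rge the by linarith
qed

section \<open>Cycles of extremal gain graphs\<close>

lemma mod_Suc_eq_Suc_mod_iff: "Suc i mod n = Suc j mod n \<longleftrightarrow> i mod n = j mod (n::nat)"
  by (auto simp: mod_Suc split: if_splits)

text \<open>There are no chords and no exits, so only the two cyclic neighbours remain. Centring the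
  statement at \<open>Suc i\<close> avoids a cyclic predecessor.\<close>

lemma cycle_nbr_iff:
  assumes x: "extremal V E \<phi>" and xs: "is_cycle_list V E xs"
    and closed: "\<forall>p\<in>set xs. \<forall>w. E p w \<longrightarrow> w \<in> set xs"
  shows "E (xs ! (Suc i mod length xs)) v \<longleftrightarrow>
    v = xs ! (i mod length xs) \<or> v = xs ! (Suc (Suc i) mod length xs)"
proof -
  note c = is_cycle_listD[OF xs]
  define n where "n = length xs"
  define s where "s i = xs ! (i mod n)" for i
  have n: "0 < n" using c(1) unfolding n_def by linarith
  have sE: "E (s i) (s (Suc i))" for i
    using c(4)[of "i mod n"] n by (simp add: s_def n_def mod_simps)
  have s_eq: "s i = s j \<longleftrightarrow> i mod n = j mod n" for i j
    using nth_eq_iff_index_eq[OF c(2), of "i mod n" "j mod n"] n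
    by (simp add: s_def n_def)
  have "v = s i \<or> v = s (Suc (Suc i))" if E: "E (s (Suc i)) v"
  proof -
    have m: "s (Suc i) \<in> set xs" using n by (simp add: s_def n_def)
    then have "{s (Suc i), v} \<in> cycle_edges xs"
      using extremal_chordless[OF x xs m] closed m E by blast
    then obtain j where j: "j < n" "{s (Suc i), v} = {xs ! j, xs ! ((j + 1) mod n)}"
      by (auto simp: cycle_edges_def n_def)
    have "{s (Suc i), v} = {s j, s (Suc j)}" using j by (simp add: s_def)
    then consider "s (Suc i) = s j" "v = s (Suc j)" | "s (Suc i) = s (Suc j)" "v = s j"
      by (auto simp: doubleton_eq_iff)
    then show ?thesis
    proof cases
      case 1
      then have "s (Suc j) = s (Suc (Suc i))" by (simp add: s_eq mod_Suc_eq_Suc_mod_iff)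
      then show ?thesis using 1 by simp
    next
      case 2
      then have "s j = s i" by (simp add: s_eq mod_Suc_eq_Suc_mod_iff)
      then show ?thesis using 2 by simp
    qed
  qed
  moreover have "E (s (Suc i)) (s i)" using simple_graphD(4)[OF extremalD(2)[OF x] sE] .
  ultimately have "E (s (Suc i)) v \<longleftrightarrow> v = s i \<or> v = s (Suc (Suc i))" using sE by blast
  then show ?thesis by (simp add: s_def n_def)
qed

lemma isolated_cycle_row_sum:
  fixes M :: "'a \<Rightarrow> 'a \<Rightarrow> 'b::field"
  assumes x: "extremal V E \<phi>" and xs: "is_cycle_list V E xs"
    and closed: "\<forall>p\<in>set xs. \<forall>w. E p w \<longrightarrow> w \<in> set xs"
    and M: "\<And>u v. \<not> E u v \<Longrightarrow> M u v = 0"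
  defines "s \<equiv> \<lambda>i. xs ! (i mod length xs)"
  shows "(\<Sum>v\<in>V. M (s (Suc i)) v * y v)
    = M (s (Suc i)) (s i) * y (s i) + M (s (Suc i)) (s (Suc (Suc i))) * y (s (Suc (Suc i)))"
proof -
  note c = is_cycle_listD[OF xs]
  have n: "0 < length xs" using c(1) by linarith
  have sV: "s j \<in> V" for j using nth_mem[of "j mod length xs" xs] c(3) n by (auto simp: s_def)
  \<comment> \<open>The two neighbours are distinct because the length is at least 3; otherwise the
    sum below would have a single term.\<close>
  have ne: "s i \<noteq> s (Suc (Suc i))"
  proof
    assume "s i = s (Suc (Suc i))"
    then have "i mod length xs = Suc (Suc i) mod length xs"
      using nth_eq_iff_index_eq[OF c(2)] n by (simp add: s_def)
    then have "length xs dvd 2" using mod_eq_dvd_iff_nat[of i "i + 2" "length xs"] by simp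
    then show False using c(1) dvd_imp_le[of "length xs" 2] by simp
  qed
  have "(\<Sum>v\<in>V. M (s (Suc i)) v * y v) = (\<Sum>v\<in>{s i, s (Suc (Suc i))}. M (s (Suc i)) v * y v)"
  proof (rule sum.mono_neutral_right)
    show "\<forall>v\<in>V - {s i, s (Suc (Suc i))}. M (s (Suc i)) v * y v = 0"
      using cycle_nbr_iff[OF x xs closed, of i] M by (auto simp: s_def)
  qed (use sV extremalD(3)[OF x] in auto)
  then show ?thesis using ne by simp
qed

text \<open>A kernel vector with entry 1 at \<open>s 0\<close> changes sign at every second vertex.
  Going round twice excludes odd length; going round once then shows that half the length is
  even.\<close>

lemma isolated_cycle_length:
  assumes x: "extremal V E \<phi>" and xs: "is_cycle_list V E xs"
    and closed: "\<forall>p\<in>set xs. \<forall>w. E p w \<longrightarrow> w \<in> set xs"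
  shows "length xs mod 4 = 0"
proof -
  note c = is_cycle_listD[OF xs] and fin = extremalD(3)[OF x]
  define n where "n = length xs"
  define s where "s i = xs ! (i mod n)" for i
  have n: "0 < n" using c(1) unfolding n_def by linarith
  have s0: "s 0 \<in> set xs" using n by (simp add: s_def n_def)
  then have s0V: "s 0 \<in> V" using c(3) by blast
  obtain k where k: "k (s 0) = 1" "\<And>i. i \<in> V \<Longrightarrow> (\<Sum>j\<in>V. adj E i j * k j) = 0"
    using kernel_vector_of_rk_delete[OF fin s0V extremal_vdel_cycle(2)[OF x xs s0]] by blast
  have step: "k (s (Suc (Suc i))) = - k (s i)" for i
  proof -
    have "s (Suc i) \<in> V" using n c(3) nth_mem[of "Suc i mod n" xs] by (auto simp: s_def n_def)
    from k(2)[OF this]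
    have "adj E (s (Suc i)) (s i) * k (s i) + adj E (s (Suc i)) (s (Suc (Suc i))) * k (s (Suc (Suc i))) = 0"
      using isolated_cycle_row_sum[OF x xs closed, where M = "adj E" and i = i and y = k] by (simp add: adj_def s_def n_def)
    moreover have "E (s (Suc i)) (s i)" "E (s (Suc i)) (s (Suc (Suc i)))"
      using cycle_nbr_iff[OF x xs closed, of i] by (auto simp: s_def n_def)
    ultimately show ?thesis by (simp add: adj_def)
  qed
  have pow: "k (s (2 * j)) = (-1) ^ j" for j
    by (induction j) (simp_all add: k(1) step)
  have per: "s (n * j) = s 0" for j by (simp add: s_def)
  have "even n"
  proof (rule ccontr)
    assume "odd n"
    then show False using pow[of n] per[of 2] k(1) by (simp add: mult.commute)
  qed
  then obtain m where m: "n = 2 * m" by blast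
  have "even m"
  proof (rule ccontr)
    assume "odd m"
    then show False using pow[of m] per[of 1] k(1) m by simp
  qed
  then show ?thesis using m by (auto simp: n_def[symmetric])
qed

text \<open>With gain \<open>(-1) ^ (n div 2)\<close> the even positions of the cycle would carry a
  kernel vector of the gain matrix with entry 1 at \<open>s 0\<close>. The rank drop by 2 at
  \<open>s 0\<close> forces every kernel vector to vanish there.\<close>

lemma isolated_cycle_type_B:
  assumes x: "extremal V E \<phi>" and xs: "is_cycle_list V E xs"
    and closed: "\<forall>p\<in>set xs. \<forall>w. E p w \<longrightarrow> w \<in> set xs"
    and ev: "even (length xs)"
  shows "type_B \<phi> xs"
proof (rule ccontr)
  assume "\<not> type_B \<phi> xs"
  then have gain: "cycle_gain \<phi> xs = (-1) ^ (length xs div 2)" using ev by (simp add: type_B_def)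
  note c = is_cycle_listD[OF xs] and fin = extremalD(3)[OF x] and gg = gain_graphD[OF extremalD(1)[OF x]]
  define n where "n = length xs"
  define s where "s i = xs ! (i mod n)" for i
  have n: "0 < n" "3 \<le> n" using c(1) unfolding n_def by linarith+
  have sE: "E (s i) (s (Suc i))" for i
    using c(4)[of "i mod n"] n by (simp add: s_def n_def mod_simps)
  \<comment> \<open>This solves the kernel equations in the odd rows step by step: each move by two
    multiplies by -1 and by the gains of the two reversed edges.\<close>
  define y where "y i = (-1) ^ (i div 2) * (\<Prod>l<i. \<phi> (s (Suc l)) (s l))" for i
  define idx where "idx = the_inv_into {..<n} ((!) xs)"
  have inj: "inj_on ((!) xs) {..<n}" using c(2) by (intro inj_on_nth) (auto simp: n_def)
  have idx: "idx (s i) = i mod n" for i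
    unfolding idx_def s_def using n(1) by (intro the_inv_into_f_f[OF inj]) simp
  define z where "z v = (if v \<in> set xs \<and> even (idx v) then y (idx v) else 0)" for v
  have s_in: "s i \<in> set xs" for i using n by (simp add: s_def n_def)
  have y0: "y 0 = 1" by (simp add: y_def)
  \<comment> \<open>The reversed gains multiply to the conjugate of the cycle gain, so the values
    close up exactly under the assumed gain.\<close>
  have yn: "y n = 1"
  proof -
    have "(\<Prod>l<n. \<phi> (s (Suc l)) (s l)) = (\<Prod>l<n. cnj (\<phi> (s l) (s (Suc l))))"
      using gg(3)[OF sE] by simp
    also have "\<dots> = cnj (cycle_gain \<phi> xs)"
      unfolding cycle_gain_def cnj_prod n_def[symmetric] by (intro prod.cong) (auto simp: s_def)
    also have "\<dots> = (-1) ^ (n div 2)" using gain by (simp add: n_def)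
    finally show ?thesis by (simp add: y_def power_mult_distrib[symmetric])
  qed
  \<comment> \<open>The case \<open>i = n\<close> is included: it wraps to position 0 and is
    consistent because \<open>y n = y 0\<close>.\<close>
  have z_even: "z (s i) = y i" if "even i" "i \<le> n" for i
  proof (cases "i = n")
    case True
    then show ?thesis using idx[of n] s_in[of n] y0 yn by (simp add: z_def)
  next
    case False
    then show ?thesis using idx[of i] s_in[of i] that by (simp add: z_def)
  qed
  have z_odd: "z (s i) = 0" if "odd i" for i
    using that ev idx[of i] by (simp add: z_def n_def dvd_mod_iff)
  have "(\<Sum>v\<in>V. gain_adj E \<phi> u v * z v) = 0" if u: "u \<in> V" for u
  proof (cases "u \<in> set xs")
    case False
    have "gain_adj E \<phi> u v * z v = 0" for v
      using False closed simple_graphD(4)[OF gg(1)] by (auto simp: gain_adj_def z_def)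
    then show ?thesis by simp
  next
    case True
    then obtain j where j: "j < n" "u = xs ! j" by (auto simp: in_set_conv_nth n_def)
    \<comment> \<open>The cyclic predecessor of \<open>j\<close>, so that \<open>u\<close> becomes
      the middle vertex \<open>s (Suc i)\<close>.\<close>
    define i where "i = (if j = 0 then n - 1 else j - 1)"
    have i: "i < n" "u = s (Suc i)" using j n by (auto simp: i_def s_def)
    have "gain_adj E \<phi> u (s i) * z (s i) + gain_adj E \<phi> u (s (Suc (Suc i))) * z (s (Suc (Suc i))) = 0"
    proof (cases "even i")
      case False
      then show ?thesis by (simp add: z_odd)
    next
      case True
      then have le: "Suc (Suc i) \<le> n" using i(1) ev
        by (metis Suc_leI dvd_add_triv_right_iff even_Suc le_neq_implies_less n_def)
      have "E u (s i)" "E u (s (Suc (Suc i)))"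
        using simple_graphD(4)[OF gg(1) sE[of i]] sE[of "Suc i"] i(2) by auto
      moreover have "z (s i) = y i" using True i(1) by (intro z_even) auto
      moreover have "z (s (Suc (Suc i))) = y (Suc (Suc i))" using True le by (intro z_even) auto
      moreover have "y (Suc (Suc i)) = - (y i * \<phi> (s (Suc i)) (s i) * \<phi> (s (Suc (Suc i))) (s (Suc i)))"
        by (simp add: y_def)
      moreover have "\<phi> (s (Suc i)) (s (Suc (Suc i))) * \<phi> (s (Suc (Suc i))) (s (Suc i)) = 1"
        using gg(4)[OF sE] .
      ultimately show ?thesis using i(2) by (simp add: gain_adj_def mult_ac)
    qed
    then show ?thesis
      using isolated_cycle_row_sum[OF x xs closed, where M = "gain_adj E \<phi>" and i = i and y = z] i(2)
      by (simp add: gain_adj_def s_def n_def)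
  qed
  moreover have "s 0 \<in> V" using s_in c(3) by blast
  ultimately have "z (s 0) = 0"
    by (rule kernel_vector_zero_of_rk_delete[OF fin _ extremal_vdel_cycle(3)[OF x xs s_in], rotated])
  then show False using z_even[of 0] y0 by simp
qed

text \<open>Vertices off \<open>xs\<close> are deleted while equality persists: first those on other
  cycles, then the outside neighbours of \<open>xs\<close>. When neither is left, \<open>xs\<close>
  is isolated.\<close>

lemma extremal_cycle_type_B:
  assumes "extremal V E \<phi>" "is_cycle_list V E xs"
  shows "type_B \<phi> xs \<and> length xs mod 4 = 0"
  using assms
proof (induction "card V" arbitrary: V E rule: less_induct)
  case less
  note x = less.prems(1) and xs = less.prems(2)
  note G = extremalD(2)[OF x] and fin = extremalD(3)[OF x]
  have IH: "type_B \<phi> xs \<and> length xs mod 4 = 0"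
    if "extremal (V - {v}) (vdel E {v}) \<phi>" "v \<in> V" "v \<notin> set xs" for v
  proof (rule less.hyps[OF _ that(1)])
    show "card (V - {v}) < card V" using fin that(2) by (rule card_Diff1_less)
    show "is_cycle_list (V - {v}) (vdel E {v}) xs" using xs that(3) by (simp add: is_cycle_list_vdel)
  qed
  show ?case
  proof (cases "\<exists>ys v. is_cycle_list V E ys \<and> v \<in> set ys \<and> v \<notin> set xs")
    case True
    then obtain ys v where ys: "is_cycle_list V E ys" "v \<in> set ys" "v \<notin> set xs" by blast
    then have "v \<in> V" using is_cycle_listD(3) by blast
    then show ?thesis using IH[OF extremal_vdel_cycle(1)[OF x ys(1,2)]] ys(3) by blast
  next
    case only: False
    show ?thesis
    proof (cases "\<exists>p w. p \<in> set xs \<and> E p w \<and> w \<notin> set xs")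
      case True
      then obtain p w where pw: "p \<in> set xs" "w \<notin> set xs" "E p w" by blast
      \<comment> \<open>Every cycle now has the vertex set of \<open>xs\<close>, so deleting
        \<open>p\<close> destroys all of them and the constant gain -1 has a potential.\<close>
      have nocyc: "\<not> is_cycle_list (V - {p}) (vdel E {p}) ys" for ys
      proof
        assume "is_cycle_list (V - {p}) (vdel E {p}) ys"
        then have ys: "is_cycle_list V E ys" "p \<notin> set ys" by (auto simp: is_cycle_list_vdel)
        have "0 < length ys" using is_cycle_listD(1)[OF ys(1)] by linarith
        then have y: "ys ! 0 \<in> set ys" by (rule nth_mem)
        then have "ys ! 0 \<in> set xs" using only ys(1) by blast
        then show False using extremal_cycles_meet(2)[OF x xs ys(1) _ y] pw(1) ys(2) by blast
      qed
      have "\<exists>f :: 'a \<Rightarrow> real. (\<forall>v. f v \<noteq> 0) \<and> (\<forall>a b. vdel E {p} a b \<longrightarrow> -1 = f a / f b)"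
        by (rule potential_exists[OF simple_graph_vdel[OF G]]) (use nocyc in auto)
      then obtain f :: "'a \<Rightarrow> real" where f: "\<And>v. f v \<noteq> 0" "\<And>a b. vdel E {p} a b \<Longrightarrow> -1 = f a / f b"
        by blast
      have neg: "f a = - f b" if "E a b" "a \<noteq> p" "b \<noteq> p" for a b
        using f(2)[of a b] f(1)[of b] that by (simp add: vdel_def field_simps)
      have "extremal (V - {w}) (vdel E {w}) \<phi>"
        by (rule extremal_vdel_exit(1)[OF x xs pw f(1)]) (rule neg)
      then show ?thesis using IH pw(2) simple_graphD(3)[OF G pw(3)] by blast
    next
      case False
      then have closed: "\<forall>p\<in>set xs. \<forall>w. E p w \<longrightarrow> w \<in> set xs" by blast
      have "length xs mod 4 = 0" using isolated_cycle_length[OF x xs closed] .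
      moreover have "even (length xs)" using calculation by presburger
      ultimately show ?thesis using isolated_cycle_type_B[OF x xs closed] by blast
    qed
  qed
qed

section \<open>Rank formulas\<close>

text \<open>All cycles are now known to be even, so the constant gain -1 is trivial on each of
  them.\<close>

lemma extremal_sign_potential:
  assumes x: "extremal V E \<phi>"
  obtains f :: "'a \<Rightarrow> real" where "\<And>v. f v \<noteq> 0" "\<And>a b. E a b \<Longrightarrow> f a = - f b"
proof -
  have "\<exists>f :: 'a \<Rightarrow> real. (\<forall>v. f v \<noteq> 0) \<and> (\<forall>a b. E a b \<longrightarrow> -1 = f a / f b)"
  proof (rule potential_exists[OF extremalD(2)[OF x]])
    fix xs assume "is_cycle_list V E xs"
    then have "even (length xs)" using extremal_cycle_type_B[OF x] by (simp add: type_B_def)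
    then show "(\<Prod>i<length xs. (-1::real)) = 1" by simp
  qed simp
  then obtain f :: "'a \<Rightarrow> real" where f: "\<And>v. f v \<noteq> 0" "\<And>a b. E a b \<Longrightarrow> -1 = f a / f b" by blast
  show thesis
  proof (rule that[of f])
    fix a b assume "E a b"
    then show "f a = - f b" using f(2)[of a b] f(1)[of b] by (simp add: field_simps)
  qed (rule f(1))
qed

text \<open>The consequences of an edge leaving a cycle, with the sign function now supplied on the
  whole graph.\<close>

lemma extremal_exit:
  assumes x: "extremal V E \<phi>" and xs: "is_cycle_list V E xs" "p \<in> set xs"
    and w: "w \<notin> set xs" "E p w"
  shows "extremal (V - {w}) (vdel E {w}) \<phi>"
    "rk V V (adj E) = rk (V - {w}) (V - {w}) (adj E) + 2"
    "\<not> (is_cycle_list V E ys \<and> w \<in> set ys)"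
    "extremal V (edel E p w) \<phi>"
    "graph_rank V (edel E p w) = graph_rank V E"
proof -
  obtain f :: "'a \<Rightarrow> real" where f: "\<And>v. f v \<noteq> 0" "\<And>a b. E a b \<Longrightarrow> f a = - f b"
    using extremal_sign_potential[OF x] by blast
  show "extremal (V - {w}) (vdel E {w}) \<phi>"
    by (rule extremal_vdel_exit(1)[OF x xs w f(1)]) (rule f(2))
  show "rk V V (adj E) = rk (V - {w}) (V - {w}) (adj E) + 2"
    by (rule graph_rank_vdel_exit[OF x xs w f(1)]) (rule f(2))
  show "\<not> (is_cycle_list V E ys \<and> w \<in> set ys)"
    by (rule extremal_vdel_exit(2)[OF x xs w f(1)]) (rule f(2))
  show "extremal V (edel E p w) \<phi>"
    by (rule extremal_vdel_exit(3)[OF x xs w f(1)]) (rule f(2))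
  show "graph_rank V (edel E p w) = graph_rank V E"
    by (rule extremal_vdel_exit(4)[OF x xs w f(1)]) (rule f(2))
qed

section \<open>Removing cycles and the rank of the acyclic part\<close>

lemma vdel_vdel: "vdel (vdel E A) B = vdel E (A \<union> B)"
  unfolding vdel_def by (intro ext) auto

lemma theta_vdel_set_le:
  assumes "simple_graph V E" "finite X" "X \<subseteq> V"
  shows "theta (V - X) (vdel E X) \<le> theta V E"
  using assms(2,3)
proof (induction X rule: finite_induct)
  case empty
  have "vdel E {} = E" unfolding vdel_def by simp
  then show ?case by simp
next
  case (insert a X)
  have "a \<in> V - X" using insert by blast
  then have "theta (V - X - {a}) (vdel (vdel E X) {a}) \<le> theta (V - X) (vdel E X)"
    using simple_graph_vdel[OF assms(1)] by (intro theta_vdel_le)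
  moreover have "V - X - {a} = V - insert a X" by blast
  ultimately show ?case using insert by (simp add: vdel_vdel)
qed

lemma cycle_of_eq_of_meet:
  assumes "extremal V E \<phi>" "is_cycle_list V E xs" "is_cycle_list V E ys" "v \<in> set xs" "v \<in> set ys"
  shows "cycle_of xs = cycle_of ys"
  using extremal_cycles_meet[OF assms] by (simp add: cycle_of_def)

lemma acyc_vertices_iff:
  "v \<in> acyc_vertices V E \<longleftrightarrow> v \<in> V \<and> (\<forall>xs. is_cycle_list V E xs \<longrightarrow> v \<notin> set xs)"
  by (auto simp: acyc_vertices_def cycles_def cycle_of_def)

lemma finite_cycles:
  assumes "finite V"
  shows "finite (cycles V E)"
proof (rule finite_subset)
  show "cycles V E \<subseteq> cycle_of ` {xs. set xs \<subseteq> V \<and> length xs \<le> card V}"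
    unfolding cycles_def
  proof (intro image_mono subsetI CollectI)
    fix xs assume "xs \<in> {xs. is_cycle_list V E xs}"
    then have c: "distinct xs" "set xs \<subseteq> V" using is_cycle_listD(2,3)[of V E xs] by simp_all
    then show "set xs \<subseteq> V \<and> length xs \<le> card V"
      using card_mono[OF assms c(2)] distinct_card[OF c(1)] by simp
  qed
  show "finite (cycle_of ` {xs. set xs \<subseteq> V \<and> length xs \<le> card V})"
    using finite_lists_length_le[OF assms] by blast
qed

text \<open>Removing one vertex turns the cycle into a separate path. The statement covers any
  matrix with the zero pattern of the graph, hence both the adjacency and the gain matrix.\<close>

lemma rk_remove_isolated_cycle:
  fixes M :: "'a \<Rightarrow> 'a \<Rightarrow> 'b::field"
  assumes x: "extremal V E \<phi>" and xs: "is_cycle_list V E xs"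
    and closed: "\<forall>p\<in>set xs. \<forall>w. E p w \<longrightarrow> w \<in> set xs"
    and M: "\<And>u v. M u v \<noteq> 0 \<longleftrightarrow> E u v"
  shows "rk (V - {hd xs}) (V - {hd xs}) M = rk (V - set xs) (V - set xs) M + (length xs - 2)"
proof -
  note c = is_cycle_listD[OF xs] and fin = extremalD(3)[OF x]
  have n: "0 < length xs" using c(1) by linarith
  then obtain p ys where ps: "xs = p # ys" by (cases xs) auto
  let ?H = "V - set xs"
  have V: "V - {hd xs} = set ys \<union> ?H" using c(2,3) ps by auto
  have "rk (set ys \<union> ?H) (set ys \<union> ?H) M = rk ?H ?H M + 2 * (length ys div 2)"
  proof (rule rk_path)
    show "finite ?H" using fin by simp
    show "distinct ys" "set ys \<inter> ?H = {}" using c(2) ps by auto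
    show "M i s = 0 \<and> M s i = 0" if "i \<in> set ys" "s \<in> ?H" for i s
    proof -
      have "\<not> E i s" using that closed ps by auto
      then have "\<not> E s i" using simple_graphD(4)[OF extremalD(2)[OF x]] by blast
      then show ?thesis using M \<open>\<not> E i s\<close> by blast
    qed
    fix i j assume ij: "i < length ys" "j < length ys"
    have E: "E (xs ! (Suc i mod length xs)) (xs ! Suc j) \<longleftrightarrow>
        xs ! Suc j = xs ! (i mod length xs) \<or> xs ! Suc j = xs ! (Suc (Suc i) mod length xs)"
      by (rule cycle_nbr_iff[OF x xs closed])
    have a: "Suc i < length xs" "Suc j < length xs" "i < length xs" using ij ps by auto
    have "xs ! Suc j = xs ! i \<longleftrightarrow> Suc j = i"
      using nth_eq_iff_index_eq[OF c(2) a(2,3)] .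
    moreover have "xs ! Suc j = xs ! (Suc (Suc i) mod length xs) \<longleftrightarrow> j = Suc i"
    proof -
      have "Suc (Suc i) mod length xs < length xs" using n by simp
      then have "xs ! Suc j = xs ! (Suc (Suc i) mod length xs) \<longleftrightarrow> Suc j = Suc (Suc i) mod length xs"
        using nth_eq_iff_index_eq[OF c(2) a(2)] by blast
      also have "\<dots> \<longleftrightarrow> j = Suc i"
      proof (cases "Suc (Suc i) < length xs")
        case False
        \<comment> \<open>Here the successor wraps to index 0, the deleted vertex, which is no entry
          of \<open>ys\<close>.\<close>
        then have "Suc (Suc i) = length xs" using a(1) by linarith
        then show ?thesis using a(2) by auto
      qed auto
      finally show ?thesis .
    qed
    moreover have "xs ! (Suc i mod length xs) = ys ! i" "xs ! Suc j = ys ! j" "i mod length xs = i"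
      using a ps by auto
    ultimately have "E (ys ! i) (ys ! j) \<longleftrightarrow> i = Suc j \<or> j = Suc i"
      using E by metis
    then show "M (ys ! i) (ys ! j) \<noteq> 0 \<longleftrightarrow> i = Suc j \<or> j = Suc i" using M by simp
  qed
  \<comment> \<open>The cycle length is even, so the path has odd length and its last vertex
    contributes nothing.\<close>
  moreover have "2 * (length ys div 2) = length xs - 2"
  proof -
    have "length xs mod 4 = 0" using extremal_cycle_type_B[OF x xs] by blast
    moreover have "length xs = Suc (length ys)" using ps by simp
    ultimately show ?thesis by presburger
  qed
  ultimately show ?thesis using V by simp
qed

text \<open>Edges leaving cycles are deleted first, changing neither the rank nor the cycles; then
  isolated cycles are split off. The measure counts edges as well, since an edge deletion keeps
  \<open>V\<close>.\<close>

lemma extremal_graph_rank: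
  assumes "extremal V E \<phi>"
  shows "int (graph_rank V E) = int (rk (acyc_vertices V E) (acyc_vertices V E) (adj E))
    + (\<Sum>Cy\<in>cycles V E. int (card (fst Cy)) - 2)"
  using assms
proof (induction "card V + card (edges V E)" arbitrary: V E rule: less_induct)
  case less
  note x = less.prems
  note G = extremalD(2)[OF x] and fin = extremalD(3)[OF x]
  consider (none) "\<And>xs. \<not> is_cycle_list V E xs"
    | (exit) xs p w where "is_cycle_list V E xs" "p \<in> set xs" "w \<notin> set xs" "E p w"
    | (closed) xs where "is_cycle_list V E xs" "\<forall>p\<in>set xs. \<forall>w. E p w \<longrightarrow> w \<in> set xs"
    by blast
  then show ?case
  proof cases
    case none
    then have "cycles V E = {}" "acyc_vertices V E = V"
      by (auto simp: cycles_def acyc_vertices_iff)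
    then show ?thesis using fin by (simp add: graph_rank_eq_rk)
  next
    case exit
    let ?F = "edel E p w"
    have "{p, w} \<notin> cycle_edges ys" if "is_cycle_list V E ys" for ys
    proof
      assume "{p, w} \<in> cycle_edges ys"
      moreover have "ys \<noteq> []" using is_cycle_listD(1)[OF that] by auto
      ultimately have "p \<in> set ys" "w \<in> set ys" using cycle_edges_Union[of ys] by blast+
      then show False using extremal_cycles_meet(2)[OF x exit(1) that exit(2)] exit(3) by blast
    qed
    then have cyc: "is_cycle_list V ?F ys \<longleftrightarrow> is_cycle_list V E ys" for ys
      by (auto simp: is_cycle_list_edel)
    then have cycles: "cycles V ?F = cycles V E" and acyc: "acyc_vertices V ?F = acyc_vertices V E"
      by (simp_all add: cycles_def acyc_vertices_def)
    have p: "p \<notin> acyc_vertices V E" using exit(1,2) by (auto simp: acyc_vertices_iff)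
    have "card V + card (edges V ?F) < card V + card (edges V E)"
      using card_edges_edel[OF G exit(4)] by simp
    from less.hyps[OF this extremal_exit(4)[OF x exit]]
    have "int (graph_rank V ?F) = int (rk (acyc_vertices V E) (acyc_vertices V E) (adj ?F))
      + (\<Sum>Cy\<in>cycles V E. int (card (fst Cy)) - 2)" by (simp add: cycles acyc)
    moreover have "rk (acyc_vertices V E) (acyc_vertices V E) (adj ?F)
        = rk (acyc_vertices V E) (acyc_vertices V E) (adj E)"
    proof (rule rk_cong)
      fix i j assume "i \<in> acyc_vertices V E" "j \<in> acyc_vertices V E"
      then have "{i, j} \<noteq> {p, w}" using p by (auto simp: doubleton_eq_iff)
      then show "adj ?F i j = adj E i j" by (simp add: adj_def edel_def)
    qed
    ultimately show ?thesis using extremal_exit(5)[OF x exit] by simp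
  next
    case closed
    note c = is_cycle_listD[OF closed(1)]
    let ?X = "set xs" and ?p = "hd xs"
    let ?H = "V - ?X" and ?F = "vdel E ?X"
    have ne: "xs \<noteq> []" using c(1) by auto
    then have p: "?p \<in> set xs" by simp
    have r: "rk V V (adj E) = rk ?H ?H (adj E) + (length xs - 2)"
      using extremal_vdel_cycle(2)[OF x closed(1) p] rk_remove_isolated_cycle[OF x closed, of "adj E"]
      by (simp add: adj_def)
    have "gain_adj E \<phi> u v \<noteq> 0 \<longleftrightarrow> E u v" for u v
      using gain_graphD(2)[OF extremalD(1)[OF x], of u v] by (auto simp: gain_adj_def)
    from rk_remove_isolated_cycle[OF x closed this]
    have r': "rk (V - {?p}) (V - {?p}) (gain_adj E \<phi>) = rk ?H ?H (gain_adj E \<phi>) + (length xs - 2)" .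
    have th: "theta ?H ?F \<le> theta (V - {?p}) (vdel E {?p})"
    proof -
      have "theta (V - {?p} - (?X - {?p})) (vdel (vdel E {?p}) (?X - {?p})) \<le> theta (V - {?p}) (vdel E {?p})"
        using c(3) by (intro theta_vdel_set_le simple_graph_vdel[OF G]) auto
      moreover have "V - {?p} - (?X - {?p}) = ?H" using p by blast
      moreover have "{?p} \<union> (?X - {?p}) = ?X" using p by blast
      ultimately show ?thesis by (simp only: vdel_vdel)
    qed
    \<comment> \<open>From the graph without \<open>?p\<close>, the rest of the cycle takes the same
      amount from both ranks, and \<open>theta\<close> does not grow, so equality survives.\<close>
    have xH: "extremal ?H ?F \<phi>"
    proof (rule extremalI)
      show "gain_graph ?H ?F \<phi>" using gain_graph_vdel[OF extremalD(1)[OF x]] .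
      show "int (graph_rank ?H ?F) + 2 * theta ?H ?F \<le> int (gain_rank ?H ?F \<phi>)"
        using extremalD(4)[OF extremal_vdel_cycle(1)[OF x closed(1) p]] r r' th
          extremal_vdel_cycle(2)[OF x closed(1) p]
        unfolding graph_rank_vdel[OF fin] gain_rank_vdel[OF fin] by linarith
    qed
    have "card ?H + card (edges ?H ?F) < card V + card (edges V E)"
    proof -
      have "card ?H < card V" using fin c(3) p by (intro psubset_card_mono) auto
      moreover have "edges ?H ?F \<subseteq> edges V E" by (auto simp: edges_def vdel_def)
      ultimately show ?thesis using card_mono[OF finite_edges[OF fin]] by (meson add_less_le_mono)
    qed
    from less.hyps[OF this xH]
    have IH: "int (graph_rank ?H ?F) = int (rk (acyc_vertices ?H ?F) (acyc_vertices ?H ?F) (adj ?F))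
      + (\<Sum>Cy\<in>cycles ?H ?F. int (card (fst Cy)) - 2)" .
    have acyc: "acyc_vertices ?H ?F = acyc_vertices V E"
    proof (rule Set.set_eqI)
      fix v
      show "v \<in> acyc_vertices ?H ?F \<longleftrightarrow> v \<in> acyc_vertices V E"
      proof
        assume v: "v \<in> acyc_vertices ?H ?F"
        have "v \<notin> set ys" if ys: "is_cycle_list V E ys" for ys
        proof
          assume vy: "v \<in> set ys"
          have "v \<notin> ?X" using v by (simp add: acyc_vertices_iff)
          then have "set ys \<noteq> ?X" using vy by blast
          then have "set ys \<inter> ?X = {}" using extremal_cycles_meet(2)[OF x ys closed(1)] by blast
          then have "is_cycle_list ?H ?F ys" using ys by (simp add: is_cycle_list_vdel)
          then show False using v vy by (simp add: acyc_vertices_iff)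
        qed
        then show "v \<in> acyc_vertices V E" using v by (simp add: acyc_vertices_iff)
      next
        assume "v \<in> acyc_vertices V E"
        then show "v \<in> acyc_vertices ?H ?F"
          using closed(1) by (auto simp: acyc_vertices_iff is_cycle_list_vdel)
      qed
    qed
    have cycles: "cycles V E = insert (cycle_of xs) (cycles ?H ?F)"
    proof
      show "insert (cycle_of xs) (cycles ?H ?F) \<subseteq> cycles V E"
        using closed(1) by (auto simp: cycles_def is_cycle_list_vdel)
      show "cycles V E \<subseteq> insert (cycle_of xs) (cycles ?H ?F)"
      proof
        fix C assume "C \<in> cycles V E"
        then obtain ys where ys: "is_cycle_list V E ys" "C = cycle_of ys" by (auto simp: cycles_def)
        show "C \<in> insert (cycle_of xs) (cycles ?H ?F)"
        proof (cases "set ys \<inter> ?X = {}")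
          case True
          then have "is_cycle_list ?H ?F ys" using ys(1) by (simp add: is_cycle_list_vdel)
          then show ?thesis using ys(2) by (simp add: cycles_def)
        next
          case False
          then show ?thesis using cycle_of_eq_of_meet[OF x ys(1) closed(1)] ys(2) by blast
        qed
      qed
    qed
    have notin: "cycle_of xs \<notin> cycles ?H ?F"
    proof
      assume "cycle_of xs \<in> cycles ?H ?F"
      then obtain ys where "set ys = ?X" "set ys \<inter> ?X = {}"
        by (auto simp: cycles_def cycle_of_def is_cycle_list_vdel)
      then show False using p by blast
    qed
    have "finite (cycles ?H ?F)" using fin by (intro finite_cycles) simp
    then have "(\<Sum>Cy\<in>cycles V E. int (card (fst Cy)) - 2)
        = int (card (set xs)) - 2 + (\<Sum>Cy\<in>cycles ?H ?F. int (card (fst Cy)) - 2)"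
      using notin by (simp add: cycles cycle_of_def)
    moreover have "int (card (set xs)) - 2 = int (length xs - 2)"
      using c(1) distinct_card[OF c(2)] by simp
    moreover have "rk (acyc_vertices V E) (acyc_vertices V E) (adj ?F)
        = rk (acyc_vertices V E) (acyc_vertices V E) (adj E)"
    proof (rule rk_cong)
      fix i j assume "i \<in> acyc_vertices V E" "j \<in> acyc_vertices V E"
      then have "i \<notin> ?X" "j \<notin> ?X" using closed(1) by (auto simp: acyc_vertices_iff)
      then show "adj ?F i j = adj E i j" by (simp add: adj_def vdel_def)
    qed
    ultimately show ?thesis
      using IH r unfolding acyc graph_rank_vdel[OF fin] graph_rank_eq_rk[OF fin] by linarith
  qed
qed

text \<open>If some edge leaves a cycle at \<open>w\<close>, deleting \<open>w\<close> gives
  matching bounds by induction. If none does, the contracted vertices are isolated and add nothing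
  to the rank.\<close>

lemma extremal_TG_rank:
  assumes "extremal V E \<phi>"
  shows "rk (TG_vertices V E) (TG_vertices V E) (adj (TG_adj_rel V E))
    = rk (acyc_vertices V E) (acyc_vertices V E) (adj E)"
  using assms
proof (induction "card V" arbitrary: V E rule: less_induct)
  case less
  note x = less.prems
  note G = extremalD(2)[OF x] and fin = extremalD(3)[OF x]
  let ?U = "acyc_vertices V E" and ?T = "TG_vertices V E" and ?A = "adj (TG_adj_rel V E)"
  have finU: "finite ?U" using fin by (simp add: acyc_vertices_def)
  have finC: "finite (cycles V E)" using finite_cycles[OF fin] .
  have finT: "finite ?T" using finU finC by (simp add: TG_vertices_def)
  have Inl: "rk (Inl ` ?U) (Inl ` ?U) ?A = rk ?U ?U (adj E)"
    unfolding rk_image[OF finU] by (rule rk_cong) (simp add: adj_def)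
  show ?case
  proof (cases "\<exists>xs p w. is_cycle_list V E xs \<and> p \<in> set xs \<and> w \<notin> set xs \<and> E p w")
    case True
    then obtain xs p w where e: "is_cycle_list V E xs" "p \<in> set xs" "w \<notin> set xs" "E p w" by blast
    let ?V = "V - {w}" and ?F = "vdel E {w}"
    have wV: "w \<in> V" using simple_graphD(3)[OF G e(4)] .
    have wcyc: "w \<notin> set ys" if "is_cycle_list V E ys" for ys
      using extremal_exit(3)[OF x e, of ys] that by blast
    have xw: "extremal ?V ?F \<phi>" using extremal_exit(1)[OF x e] .
    have cyc: "is_cycle_list ?V ?F ys \<longleftrightarrow> is_cycle_list V E ys" for ys
      using wcyc by (auto simp: is_cycle_list_vdel)
    then have cycles: "cycles ?V ?F = cycles V E" by (simp add: cycles_def)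
    have acyc: "acyc_vertices ?V ?F = ?U - {w}" using cyc by (auto simp: acyc_vertices_iff)
    have wC: "w \<notin> fst C" if "C \<in> cycles V E" for C
      using that wcyc by (auto simp: cycles_def cycle_of_def)
    have TV: "TG_vertices ?V ?F = ?T - {Inl w}"
      by (auto simp: TG_vertices_def cycles acyc)
    have F: "?F a b \<longleftrightarrow> E a b \<and> a \<noteq> w \<and> b \<noteq> w" for a b by (simp add: vdel_def)
    have adjT: "adj (TG_adj_rel ?V ?F) i j = ?A i j" if "i \<in> ?T - {Inl w}" "j \<in> ?T - {Inl w}" for i j
    proof -
      have "TG_adj_rel ?V ?F i j \<longleftrightarrow> TG_adj_rel V E i j"
      proof (cases i)
        case i: (Inl a)
        show ?thesis
        proof (cases j)
          case (Inl b)
          then show ?thesis using i that by (auto simp: acyc F)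
        next
          case (Inr D)
          then show ?thesis using i that wC[of D] by (auto simp: acyc cycles F)
        qed
      next
        case i: (Inr C)
        show ?thesis
        proof (cases j)
          case (Inl b)
          then show ?thesis using i that wC[of C] by (auto simp: acyc cycles F)
        next
          case (Inr D)
          then show ?thesis using i that wC[of C] wC[of D] by (auto simp: cycles F)
        qed
      qed
      then show ?thesis by (simp add: adj_def)
    qed
    have cU: "rk (?U - {w}) (?U - {w}) (adj ?F) = rk (?U - {w}) (?U - {w}) (adj E)"
      by (rule rk_cong) (simp add: adj_def vdel_def)
    have "card ?V < card V" using fin wV by (rule card_Diff1_less)
    from less.hyps[OF this xw]
    have "rk (?T - {Inl w}) (?T - {Inl w}) (adj (TG_adj_rel ?V ?F)) = rk (?U - {w}) (?U - {w}) (adj E)"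
      unfolding TV acyc cU .
    moreover have "rk (?T - {Inl w}) (?T - {Inl w}) (adj (TG_adj_rel ?V ?F)) = rk (?T - {Inl w}) (?T - {Inl w}) ?A"
      by (rule rk_cong) (rule adjT)
    ultimately have IH: "rk (?T - {Inl w}) (?T - {Inl w}) ?A = rk (?U - {w}) (?U - {w}) (adj E)" by simp
    have "rk ?T ?T ?A \<le> rk (?U - {w}) (?U - {w}) (adj E) + 2"
      using rk_delete_le[OF finT, of ?A "Inl w"] IH by simp
    \<comment> \<open>The graphs with and without \<open>w\<close> have the same cycles, so the
      cycle sums in their rank formulas cancel and the drop by 2 passes to the acyclic part.\<close>
    moreover have "rk ?U ?U (adj E) = rk (?U - {w}) (?U - {w}) (adj E) + 2"
      using extremal_graph_rank[OF x] extremal_graph_rank[OF xw] extremal_exit(2)[OF x e]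
      unfolding acyc cycles cU graph_rank_vdel[OF fin] graph_rank_eq_rk[OF fin] by linarith
    moreover have "rk ?U ?U (adj E) \<le> rk ?T ?T ?A"
      using rk_mono[OF finT, of "Inl ` ?U" ?A] Inl by (simp add: TG_vertices_def)
    ultimately show ?thesis by linarith
  next
    case False
    then have closed: "w \<in> fst C" if "C \<in> cycles V E" "p \<in> fst C" "E p w" for C p w
      using that by (fastforce simp: cycles_def cycle_of_def)
    have T: "?T = Inr ` cycles V E \<union> Inl ` ?U" by (auto simp: TG_vertices_def)
    have noU: "\<not> E u p" if "u \<in> ?U" "C \<in> cycles V E" "p \<in> fst C" for u p C
      using closed[OF that(2,3), of u] that(1,2) simple_graphD(4)[OF G] by (auto simp: acyc_vertices_def)
    have noC: "\<not> E a b" if CD: "C \<in> cycles V E" "D \<in> cycles V E" "C \<noteq> D" "a \<in> fst C" "b \<in> fst D" for C D a b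
    proof
      assume "E a b"
      then have bC: "b \<in> fst C" using closed[OF CD(1,4)] by blast
      obtain ys zs where "is_cycle_list V E ys" "C = cycle_of ys" "is_cycle_list V E zs" "D = cycle_of zs"
        using CD(1,2) by (auto simp: cycles_def)
      then show False
        using cycle_of_eq_of_meet[OF x, of ys zs b] bC CD(3,5) by (simp add: cycle_of_def)
    qed
    have "rk ?T ?T ?A = rk (Inl ` ?U) (Inl ` ?U) ?A"
      unfolding T
    proof (rule rk_Un_zero)
      fix i u :: "'a + 'a set \<times> 'a set set"
      assume i: "i \<in> Inr ` cycles V E \<union> Inl ` ?U" and "u \<in> Inr ` cycles V E"
      then obtain C where C: "u = Inr C" "C \<in> cycles V E" by blast
      have "\<not> TG_adj_rel V E i u \<and> \<not> TG_adj_rel V E u i"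
      proof (cases i)
        case (Inl a)
        then show ?thesis using C(1) noU[of a C] by auto
      next
        case (Inr D)
        then show ?thesis using C(1) noC[of C D] noC[of D C] by auto
      qed
      then show "?A i u = 0 \<and> ?A u i = 0" by (simp add: adj_def)
    qed (use finU finC in auto)
    then show ?thesis using Inl by simp
  qed
qed

theorem theorem4p7:
  fixes V :: "'a set" and E :: "'a \<Rightarrow> 'a \<Rightarrow> bool" and \<phi> :: "'a \<Rightarrow> 'a \<Rightarrow> complex"
  assumes "gain_graph V E \<phi>"
    and "int (gain_rank V E \<phi>) = int (graph_rank V E) + 2 * theta V E"
  shows "cycles_vertex_disjoint V E
    \<and> (\<forall>xs. is_cycle_list V E xs \<longrightarrow> type_B \<phi> xs \<and> length xs mod 4 = 0)
    \<and> int (graph_rank V E) = int (graph_rank (TG_vertices V E) (TG_adj_rel V E))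
           + (\<Sum>Cy \<in> cycles V E. int (card (fst Cy)) - 2)
    \<and> graph_rank (TG_vertices V E) (TG_adj_rel V E)
           = graph_rank (acyc_vertices V E) (Gamma_adj_rel V E)"
proof -
  have x: "extremal V E \<phi>" using assms by (simp add: extremal_def)
  have fin: "finite V" using extremalD(3)[OF x] .
  have finU: "finite (acyc_vertices V E)" using fin by (simp add: acyc_vertices_def)
  have finT: "finite (TG_vertices V E)" using finU finite_cycles[OF fin] by (simp add: TG_vertices_def)
  have "cycles_vertex_disjoint V E"
    unfolding cycles_vertex_disjoint_def
  proof (intro ballI impI)
    fix C D assume "C \<in> cycles V E" "D \<in> cycles V E" "C \<noteq> D"
    then obtain xs ys where "is_cycle_list V E xs" "C = cycle_of xs" "is_cycle_list V E ys" "D = cycle_of ys"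
      by (auto simp: cycles_def)
    then show "fst C \<inter> fst D = {}"
      using cycle_of_eq_of_meet[OF x, of xs ys] \<open>C \<noteq> D\<close> by (auto simp: cycle_of_def)
  qed
  moreover have "\<forall>xs. is_cycle_list V E xs \<longrightarrow> type_B \<phi> xs \<and> length xs mod 4 = 0"
    using extremal_cycle_type_B[OF x] by blast
  moreover have T: "graph_rank (TG_vertices V E) (TG_adj_rel V E)
      = rk (acyc_vertices V E) (acyc_vertices V E) (adj E)"
    using extremal_TG_rank[OF x] finT by (simp add: graph_rank_eq_rk)
  moreover have "graph_rank (acyc_vertices V E) (Gamma_adj_rel V E)
      = rk (acyc_vertices V E) (acyc_vertices V E) (adj E)"
    unfolding graph_rank_eq_rk[OF finU] by (rule rk_cong) (simp add: adj_def Gamma_adj_rel_def)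
  moreover have "int (graph_rank V E) = int (graph_rank (TG_vertices V E) (TG_adj_rel V E))
      + (\<Sum>Cy \<in> cycles V E. int (card (fst Cy)) - 2)"
    using extremal_graph_rank[OF x] T by simp
  ultimately show ?thesis by simp
qed

end
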